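(* Let $M$ be a plain (respectively, symmetric) multicategory with set of objects $X$, let $\Phi$ be a multigraph with vertex set $X$, and let $\phi:F_{\rm pl}\Phi\to M$ be a regular epimorphism in $\mathbf{Multicat}_X$ (respectively, $\phi:F_\Sigma\Phi\to M$ a regular epimorphism in $\Sigma\text{-}\mathbf{Multicat}_X$). Then the weakening $\mathrm{Wk}_\phi(M)$ of $M$ with respect to $\phi$ is equivalent, as a $\mathbf{Cat}$-multicategory (respectively, symmetric $\mathbf{Cat}$-multicategory), to the unbiased weakening $\mathrm{Wk}(M)$.
   Context: A (plain) multicategory has objects, hom-sets $M(x_1,\dots,x_n;x)$ for $n\ge0$, associative composition $f\circ(f_1,\dots,f_n)$ and identities; it is symmetric if it has actions of the symmetric groups permuting inputs, compatible with composition in the usual way. A multigraph with vertex set $X$ is a family of sets $E(x_1,\dots,x_n;x)$ of "funnels", one for each $n\ge 0$ and $x_1,\dots,x_n,x\in X$. $\mathbf{Multigraph}_X$, $\mathbf{Multicat}_X$, $\Sigma\text{-}\mathbf{Multicat}_X$ are the categories of multigraphs, multicategories and symmetric multicategories with vertex/object set $X$ and identity-on-objects maps. $F_{\rm pl}$ and $F_\Sigma$ are the left adjoints to the forgetful functors $U^{\rm pl}:\mathbf{Multicat}_X\to\mathbf{Multigraph}_X$ and $U^\Sigma:\Sigma\text{-}\mathbf{Multicat}_X\to\mathbf{Multigraph}_X$. A (symmetric) $\mathbf{Cat}$-multicategory has hom-categories in place of hom-sets, with composition (and actions) functorial and axioms strict; $D_*M$ is the (symmetric) $\mathbf{Cat}$-multicategory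 obtained by regarding each hom-set of $M$ as a discrete category. (Symmetric) $\mathbf{Cat}$-multicategories with object set $X$, identity-on-objects maps, and transformations form a 2-category, where a transformation $\eta:\alpha\to\beta$ between maps $M\to N$ is a family of natural transformations between the functors $M(x_1,\dots,x_n;x)\to N(x_1,\dots,x_n;x)$ given by $\alpha$ and $\beta$, compatible with composition ($\eta_{p\circ(p_1,\dots,p_n)}=\eta_p\circ(\eta_{p_1},\dots,\eta_{p_n})$), identities ($\eta_1=1$) and, in the symmetric case, the actions ($\eta_{\sigma\cdot p}=\sigma\cdot\eta_p$). Equivalence means equivalence in this 2-category. Weakening: $\mathrm{Wk}_\phi(M)$ is the (unique up to isomorphism) (symmetric) $\mathbf{Cat}$-multicategory with object set $X$ in a factorization $D_*F\Phi\xrightarrow{b}\mathrm{Wk}_\phi(M)\xrightarrow{f}D_*M$ of $D_*\phi$ (where $F$ is $F_{\rm pl}$, resp. $F_\Sigma$) such that $b$ is bijective on the objects of every hom-category and $f$ is full and faithful on every hom-category. The unbiased weakening $\mathrm{Wk}(M)$ is the weakening with respect to the component at $M$ of the counit of $F_{\rm pl}\dashv U^{\rm pl}$ (resp. $F_\Sigma\dashv U^\Sigma$). *)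

theory Defs
  imports "HOL-Combinatorics.Permutations"
begin

datatype flavour = Plain | Symmetric

section \<open>Multigraphs and multicategories\<close>

text \<open>The sets \<open>E(xs; x)\<close> of a multigraph are the fibres \<open>hom E xs x\<close>
  of the input and output maps on a single set of arrows (funnels).\<close>

record ('x, 'e) multigraph =
  arr :: "'e set"
  inp :: "'e \<Rightarrow> 'x list"
  out :: "'e \<Rightarrow> 'x"

definition hom :: "('x, 'e, 'z) multigraph_scheme \<Rightarrow> 'x list \<Rightarrow> 'x \<Rightarrow> 'e set" where
  "hom E xs x = {e \<in> arr E. inp E e = xs \<and> out E e = x}"

definition multigraph :: "'x set \<Rightarrow> ('x, 'e, 'z) multigraph_scheme \<Rightarrow> bool" where
  "multigraph X E \<longleftrightarrow> (\<forall>e \<in> arr E. set (inp E e) \<subseteq> X \<and> out E e \<in> X)"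

definition multigraph_map ::
  "('x, 'e, 'z) multigraph_scheme \<Rightarrow> ('x, 'f, 'w) multigraph_scheme \<Rightarrow> ('e \<Rightarrow> 'f) \<Rightarrow> bool" where
  "multigraph_map E E' h \<longleftrightarrow> (\<forall>e \<in> arr E. h e \<in> hom E' (inp E e) (out E e))"

text \<open>The field \<open>act\<close> carries no meaning for plain multicategories: every axiom about it is
  guarded by the flavour.\<close>

record ('x, 'm) multicat = "('x, 'm) multigraph" +
  idn :: "'x \<Rightarrow> 'm"
  mcomp :: "'m \<Rightarrow> 'm list \<Rightarrow> 'm"
  act :: "(nat \<Rightarrow> nat) \<Rightarrow> 'm \<Rightarrow> 'm"

definition composable :: "('x, 'm, 'z) multigraph_scheme \<Rightarrow> 'm \<Rightarrow> 'm list \<Rightarrow> bool" where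
  "composable M f fs \<longleftrightarrow> f \<in> arr M \<and> set fs \<subseteq> arr M \<and> map (out M) fs = inp M f"

text \<open>Position \<open>m\<close> in a concatenation of blocks of lengths \<open>ks\<close> is position \<open>j\<close> of block \<open>i\<close>,
  where \<open>(i, j) = unflat ks m\<close>.\<close>

fun unflat :: "nat list \<Rightarrow> nat \<Rightarrow> nat \<times> nat" where
  "unflat [] m = (0, m)"
| "unflat (k # ks) m =
    (if m < k then (0, m) else (case unflat ks (m - k) of (i, j) \<Rightarrow> (Suc i, j)))"

text \<open>The permutation moving the \<open>i\<close>-th block to the \<open>\<sigma> i\<close>-th place, each block
  being kept in order; and the block sum of the permutations \<open>\<sigma>s\<close>.\<close>

definition block_perm :: "(nat \<Rightarrow> nat) \<Rightarrow> nat list \<Rightarrow> nat \<Rightarrow> nat" where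
  "block_perm \<sigma> ks m =
    (if m < sum_list ks
     then (case unflat ks m of (i, j) \<Rightarrow> sum_list (take (\<sigma> i) (permute_list (inv \<sigma>) ks)) + j)
     else m)"

definition sum_perm :: "(nat \<Rightarrow> nat) list \<Rightarrow> nat list \<Rightarrow> nat \<Rightarrow> nat" where
  "sum_perm \<sigma>s ks m =
    (if m < sum_list ks
     then (case unflat ks m of (i, j) \<Rightarrow> sum_list (take i ks) + (\<sigma>s ! i) j)
     else m)"

text \<open>The symmetric groups act on the left: the \<open>i\<close>-th input of \<open>f\<close> is the \<open>\<sigma> i\<close>-th
  input of \<open>\<sigma> \<cdot> f\<close>, so the \<open>i\<close>-th entry of the new input list is entry \<open>inv \<sigma> i\<close> of the old
  one.\<close>

locale multicategory =
  fixes k :: flavour and X :: "'x set" and M :: "('x, 'm, 'z) multicat_scheme"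
  assumes graph: "multigraph X M"
    and idn_hom: "x \<in> X \<Longrightarrow> idn M x \<in> hom M [x] x"
    and mcomp_hom: "composable M f fs \<Longrightarrow>
          mcomp M f fs \<in> hom M (concat (map (inp M) fs)) (out M f)"
    and mcomp_idn: "f \<in> arr M \<Longrightarrow> mcomp M f (map (idn M) (inp M f)) = f"
    and idn_mcomp: "f \<in> arr M \<Longrightarrow> mcomp M (idn M (out M f)) [f] = f"
    and mcomp_assoc: "\<lbrakk>composable M f fs; list_all2 (composable M) fs gss\<rbrakk> \<Longrightarrow>
          mcomp M (mcomp M f fs) (concat gss) = mcomp M f (map2 (mcomp M) fs gss)"
    and act_hom: "\<lbrakk>k = Symmetric; f \<in> arr M; \<sigma> permutes {..<length (inp M f)}\<rbrakk> \<Longrightarrow>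
          act M \<sigma> f \<in> hom M (permute_list (inv \<sigma>) (inp M f)) (out M f)"
    and act_id: "\<lbrakk>k = Symmetric; f \<in> arr M\<rbrakk> \<Longrightarrow> act M id f = f"
    and act_act: "\<lbrakk>k = Symmetric; f \<in> arr M;
          \<sigma> permutes {..<length (inp M f)}; \<tau> permutes {..<length (inp M f)}\<rbrakk> \<Longrightarrow>
          act M (\<sigma> \<circ> \<tau>) f = act M \<sigma> (act M \<tau> f)"
    and mcomp_act_left: "\<lbrakk>k = Symmetric; composable M f fs;
          \<sigma> permutes {..<length (inp M f)}\<rbrakk> \<Longrightarrow>
          mcomp M (act M \<sigma> f) (permute_list (inv \<sigma>) fs) =
          act M (block_perm \<sigma> (map (length \<circ> inp M) fs)) (mcomp M f fs)"
    and mcomp_act_right: "\<lbrakk>k = Symmetric; composable M f fs;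
          list_all2 (\<lambda>\<sigma> g. \<sigma> permutes {..<length (inp M g)}) \<sigma>s fs\<rbrakk> \<Longrightarrow>
          mcomp M f (map2 (act M) \<sigma>s fs) =
          act M (sum_perm \<sigma>s (map (length \<circ> inp M) fs)) (mcomp M f fs)"

definition multicat_map ::
  "flavour \<Rightarrow> 'x set \<Rightarrow> ('x, 'm, 'z) multicat_scheme \<Rightarrow> ('x, 'n, 'w) multicat_scheme \<Rightarrow>
   ('m \<Rightarrow> 'n) \<Rightarrow> bool" where
  "multicat_map k X M N h \<longleftrightarrow>
     multigraph_map M N h \<and>
     (\<forall>x \<in> X. h (idn M x) = idn N x) \<and>
     (\<forall>f fs. composable M f fs \<longrightarrow> h (mcomp M f fs) = mcomp N (h f) (map h fs)) \<and>
     (k = Symmetric \<longrightarrow> (\<forall>f \<in> arr M. \<forall>\<sigma>. \<sigma> permutes {..<length (inp M f)} \<longrightarrow>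
        h (act M \<sigma> f) = act N \<sigma> (h f)))"

definition forget :: "('x, 'm) multicat \<Rightarrow> ('x, 'm) multigraph" where
  "forget M = multigraph.truncate M"


section \<open>Regular epimorphisms\<close>

text \<open>HOL cannot quantify over types inside a formula, so the type \<open>'t\<close> of the arrows of the
  test objects is a parameter here. Below, \<open>regular_epi\<close> uses fixed types, and
  \<open>coequalizer_any_type\<close> and \<open>regular_epiI\<close> show that this loses nothing.\<close>

definition coequalizer ::
  "'t itself \<Rightarrow> flavour \<Rightarrow> 'x set \<Rightarrow> ('x, 'r) multicat \<Rightarrow> ('r \<Rightarrow> 'a) \<Rightarrow> ('r \<Rightarrow> 'a) \<Rightarrow>
   ('x, 'a) multicat \<Rightarrow> ('x, 'm) multicat \<Rightarrow> ('a \<Rightarrow> 'm) \<Rightarrow> bool" where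
  "coequalizer _ k X R f g A M q \<longleftrightarrow>
     multicategory k X R \<and> multicategory k X A \<and> multicategory k X M \<and>
     multicat_map k X R A f \<and> multicat_map k X R A g \<and> multicat_map k X A M q \<and>
     (\<forall>r \<in> arr R. q (f r) = q (g r)) \<and>
     (\<forall>(T :: ('x, 't) multicat) h.
        multicategory k X T \<and> multicat_map k X A T h \<and> (\<forall>r \<in> arr R. h (f r) = h (g r)) \<longrightarrow>
        (\<exists>u. multicat_map k X M T u \<and> (\<forall>a \<in> arr A. u (q a) = h a) \<and>
          (\<forall>v. multicat_map k X M T v \<and> (\<forall>a \<in> arr A. v (q a) = h a) \<longrightarrow>
             (\<forall>m \<in> arr M. v m = u m))))"

definition regular_epi ::
  "flavour \<Rightarrow> 'x set \<Rightarrow> ('x, 'a) multicat \<Rightarrow> ('x, 'm) multicat \<Rightarrow> ('a \<Rightarrow> 'm) \<Rightarrow> bool" where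
  "regular_epi k X A M q \<longleftrightarrow>
     (\<exists>(R :: ('x, 'a \<times> 'a) multicat) f g. coequalizer TYPE('a + 'm) k X R f g A M q)"


section \<open>Free multicategories\<close>

text \<open>Formal composites of funnels modulo the least congruence that enforces the multicategory
  axioms. That this is left adjoint to \<open>forget\<close>, with unit \<open>free_unit\<close>, is proved below
  (\<open>multicategory_free\<close>, \<open>free_unit_map\<close>, \<open>free_ext_map\<close>, \<open>free_ext_unit\<close>, \<open>free_ext_unique\<close>).\<close>

datatype ('x, 'e) mterm =
  Gen 'e | Idn 'x | Comp "('x, 'e) mterm" "('x, 'e) mterm list" | Act "nat \<Rightarrow> nat" "('x, 'e) mterm"

primrec tout :: "('x, 'e) multigraph \<Rightarrow> ('x, 'e) mterm \<Rightarrow> 'x" where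
  "tout E (Gen e) = out E e"
| "tout E (Idn x) = x"
| "tout E (Comp t ts) = tout E t"
| "tout E (Act \<sigma> t) = tout E t"

primrec tinp :: "('x, 'e) multigraph \<Rightarrow> ('x, 'e) mterm \<Rightarrow> 'x list" where
  "tinp E (Gen e) = inp E e"
| "tinp E (Idn x) = [x]"
| "tinp E (Comp t ts) = concat (map (tinp E) ts)"
| "tinp E (Act \<sigma> t) = permute_list (inv \<sigma>) (tinp E t)"

inductive_set terms :: "flavour \<Rightarrow> 'x set \<Rightarrow> ('x, 'e) multigraph \<Rightarrow> ('x, 'e) mterm set"
  for k X E where
  Gen: "e \<in> arr E \<Longrightarrow> Gen e \<in> terms k X E"
| Idn: "x \<in> X \<Longrightarrow> Idn x \<in> terms k X E"
| Comp: "\<lbrakk>t \<in> terms k X E; \<forall>s \<in> set ts. s \<in> terms k X E; map (tout E) ts = tinp E t\<rbrakk> \<Longrightarrow>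
    Comp t ts \<in> terms k X E"
| Act: "\<lbrakk>k = Symmetric; t \<in> terms k X E; \<sigma> permutes {..<length (tinp E t)}\<rbrakk> \<Longrightarrow>
    Act \<sigma> t \<in> terms k X E"

inductive teq :: "flavour \<Rightarrow> 'x set \<Rightarrow> ('x, 'e) multigraph \<Rightarrow>
    ('x, 'e) mterm \<Rightarrow> ('x, 'e) mterm \<Rightarrow> bool"
  for k X E where
  refl: "t \<in> terms k X E \<Longrightarrow> teq k X E t t"
| sym: "teq k X E t u \<Longrightarrow> teq k X E u t"
| trans: "\<lbrakk>teq k X E t u; teq k X E u v\<rbrakk> \<Longrightarrow> teq k X E t v"
| Comp_cong: "\<lbrakk>Comp t ts \<in> terms k X E; teq k X E t u; list_all2 (teq k X E) ts us\<rbrakk> \<Longrightarrow>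
    teq k X E (Comp t ts) (Comp u us)"
| Act_cong: "\<lbrakk>Act \<sigma> t \<in> terms k X E; teq k X E t u\<rbrakk> \<Longrightarrow> teq k X E (Act \<sigma> t) (Act \<sigma> u)"
| Comp_Idn: "t \<in> terms k X E \<Longrightarrow> teq k X E (Comp t (map Idn (tinp E t))) t"
| Idn_Comp: "t \<in> terms k X E \<Longrightarrow> teq k X E (Comp (Idn (tout E t)) [t]) t"
| Comp_assoc: "\<lbrakk>Comp t ts \<in> terms k X E;
    list_all2 (\<lambda>s us. Comp s us \<in> terms k X E) ts uss\<rbrakk> \<Longrightarrow>
    teq k X E (Comp (Comp t ts) (concat uss)) (Comp t (map2 Comp ts uss))"
| Act_id: "Act id t \<in> terms k X E \<Longrightarrow> teq k X E (Act id t) t"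
| Act_Act: "\<lbrakk>Act \<sigma> t \<in> terms k X E; Act \<tau> t \<in> terms k X E\<rbrakk> \<Longrightarrow>
    teq k X E (Act (\<sigma> \<circ> \<tau>) t) (Act \<sigma> (Act \<tau> t))"
| Comp_Act_left: "\<lbrakk>Comp t ts \<in> terms k X E; Act \<sigma> t \<in> terms k X E\<rbrakk> \<Longrightarrow>
    teq k X E (Comp (Act \<sigma> t) (permute_list (inv \<sigma>) ts))
      (Act (block_perm \<sigma> (map (length \<circ> tinp E) ts)) (Comp t ts))"
| Comp_Act_right: "\<lbrakk>k = Symmetric; Comp t ts \<in> terms k X E;
    list_all2 (\<lambda>\<sigma> s. Act \<sigma> s \<in> terms k X E) \<sigma>s ts\<rbrakk> \<Longrightarrow>
    teq k X E (Comp t (map2 Act \<sigma>s ts))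
      (Act (sum_perm \<sigma>s (map (length \<circ> tinp E) ts)) (Comp t ts))"

definition tclass :: "flavour \<Rightarrow> 'x set \<Rightarrow> ('x, 'e) multigraph \<Rightarrow> ('x, 'e) mterm \<Rightarrow>
    ('x, 'e) mterm set" where
  "tclass k X E t = {u. teq k X E t u}"

definition rep :: "'a set \<Rightarrow> 'a" where
  "rep c = (SOME t. t \<in> c)"

definition free :: "flavour \<Rightarrow> 'x set \<Rightarrow> ('x, 'e) multigraph \<Rightarrow>
    ('x, ('x, 'e) mterm set) multicat" where
  "free k X E =
    \<lparr>arr = tclass k X E ` terms k X E,
     inp = (\<lambda>c. tinp E (rep c)),
     out = (\<lambda>c. tout E (rep c)),
     idn = (\<lambda>x. tclass k X E (Idn x)),
     mcomp = (\<lambda>c cs. tclass k X E (Comp (rep c) (map rep cs))),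
     act = (\<lambda>\<sigma> c. tclass k X E (Act \<sigma> (rep c)))\<rparr>"

definition free_unit :: "flavour \<Rightarrow> 'x set \<Rightarrow> ('x, 'e) multigraph \<Rightarrow> 'e \<Rightarrow>
    ('x, 'e) mterm set" where
  "free_unit k X E e = tclass k X E (Gen e)"

primrec teval :: "('x, 'm, 'z) multicat_scheme \<Rightarrow> ('e \<Rightarrow> 'm) \<Rightarrow> ('x, 'e) mterm \<Rightarrow> 'm" where
  "teval M h (Gen e) = h e"
| "teval M h (Idn x) = idn M x"
| "teval M h (Comp t ts) = mcomp M (teval M h t) (map (teval M h) ts)"
| "teval M h (Act \<sigma> t) = act M \<sigma> (teval M h t)"

definition free_ext :: "('x, 'm) multicat \<Rightarrow> ('e \<Rightarrow> 'm) \<Rightarrow> ('x, 'e) mterm set \<Rightarrow> 'm" where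
  "free_ext M h c = teval M h (rep c)"

text \<open>The counit at \<open>M\<close> of the adjunction between \<open>free\<close> and \<open>forget\<close>: a map
  \<open>free k X (forget M) \<rightarrow> M\<close>.\<close>

definition counit :: "('x, 'm) multicat \<Rightarrow> ('x, 'm) mterm set \<Rightarrow> 'm" where
  "counit M = free_ext M (\<lambda>m. m)"


section \<open>Cat-multicategories\<close>

text \<open>The arrows are the objects of the hom-categories and \<open>cells\<close> are their morphisms;
  \<open>vcomp C \<beta> \<alpha>\<close> is \<open>\<beta>\<close> after \<open>\<alpha>\<close> in a hom-category. The fields \<open>cmcomp\<close> and \<open>cact\<close> are the
  effect of composition and of the actions on morphisms of hom-categories.\<close>

record ('x, 'p, 'c) cat_multicat = "('x, 'p) multicat" +
  cells :: "'c set"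
  src :: "'c \<Rightarrow> 'p"
  tgt :: "'c \<Rightarrow> 'p"
  vid :: "'p \<Rightarrow> 'c"
  vcomp :: "'c \<Rightarrow> 'c \<Rightarrow> 'c"
  cmcomp :: "'c \<Rightarrow> 'c list \<Rightarrow> 'c"
  cact :: "(nat \<Rightarrow> nat) \<Rightarrow> 'c \<Rightarrow> 'c"

definition cell :: "('x, 'p, 'c) cat_multicat \<Rightarrow> 'p \<Rightarrow> 'p \<Rightarrow> 'c set" where
  "cell C p q = {\<alpha> \<in> cells C. src C \<alpha> = p \<and> tgt C \<alpha> = q}"

definition cell_multicat :: "('x, 'p, 'c) cat_multicat \<Rightarrow> ('x, 'c) multicat" where
  "cell_multicat C =
    \<lparr>arr = cells C, inp = (\<lambda>\<alpha>. inp C (src C \<alpha>)), out = (\<lambda>\<alpha>. out C (src C \<alpha>)),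
     idn = (\<lambda>x. vid C (idn C x)), mcomp = cmcomp C, act = cact C\<rparr>"

text \<open>The assumptions \<open>object_level\<close> and \<open>morphism_level\<close> state the strict axioms for the two components
  of the composition and action functors. That \<open>src\<close>, \<open>tgt\<close> and \<open>vid\<close> are maps of
  multicategories and the last two assumptions state that these are indeed functors (and that
  \<open>src\<close> and \<open>tgt\<close> of a cell lie in the same hom-set).\<close>

locale cat_multicategory =
  fixes k :: flavour and X :: "'x set" and C :: "('x, 'p, 'c) cat_multicat"
  assumes object_level: "multicategory k X C"
    and morphism_level: "multicategory k X (cell_multicat C)"
    and src_map: "multicat_map k X (cell_multicat C) C (src C)"
    and tgt_map: "multicat_map k X (cell_multicat C) C (tgt C)"
    and vid_map: "multicat_map k X C (cell_multicat C) (vid C)"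
    and vid_cell: "p \<in> arr C \<Longrightarrow> vid C p \<in> cell C p p"
    and vcomp_cell: "\<lbrakk>\<alpha> \<in> cell C p q; \<beta> \<in> cell C q r\<rbrakk> \<Longrightarrow> vcomp C \<beta> \<alpha> \<in> cell C p r"
    and vcomp_vid: "\<alpha> \<in> cell C p q \<Longrightarrow> vcomp C \<alpha> (vid C p) = \<alpha>"
    and vid_vcomp: "\<alpha> \<in> cell C p q \<Longrightarrow> vcomp C (vid C q) \<alpha> = \<alpha>"
    and vcomp_assoc: "\<lbrakk>\<alpha> \<in> cell C p q; \<beta> \<in> cell C q r; \<gamma> \<in> cell C r s\<rbrakk> \<Longrightarrow>
          vcomp C \<gamma> (vcomp C \<beta> \<alpha>) = vcomp C (vcomp C \<gamma> \<beta>) \<alpha>"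
    and cmcomp_vcomp: "\<lbrakk>composable (cell_multicat C) \<alpha> \<alpha>s; composable (cell_multicat C) \<beta> \<beta>s;
          tgt C \<alpha> = src C \<beta>; map (tgt C) \<alpha>s = map (src C) \<beta>s\<rbrakk> \<Longrightarrow>
          cmcomp C (vcomp C \<beta> \<alpha>) (map2 (vcomp C) \<beta>s \<alpha>s) = vcomp C (cmcomp C \<beta> \<beta>s) (cmcomp C \<alpha> \<alpha>s)"
    and cact_vcomp: "\<lbrakk>k = Symmetric; \<alpha> \<in> cell C p q; \<beta> \<in> cell C q r;
          \<sigma> permutes {..<length (inp C p)}\<rbrakk> \<Longrightarrow>
          cact C \<sigma> (vcomp C \<beta> \<alpha>) = vcomp C (cact C \<sigma> \<beta>) (cact C \<sigma> \<alpha>)"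

definition cat_multicat_map ::
  "flavour \<Rightarrow> 'x set \<Rightarrow> ('x, 'p, 'c) cat_multicat \<Rightarrow> ('x, 'q, 'd) cat_multicat \<Rightarrow>
   ('p \<Rightarrow> 'q) \<Rightarrow> ('c \<Rightarrow> 'd) \<Rightarrow> bool" where
  "cat_multicat_map k X C D F0 F1 \<longleftrightarrow>
     multicat_map k X C D F0 \<and>
     multicat_map k X (cell_multicat C) (cell_multicat D) F1 \<and>
     (\<forall>\<alpha> \<in> cells C. F1 \<alpha> \<in> cell D (F0 (src C \<alpha>)) (F0 (tgt C \<alpha>))) \<and>
     (\<forall>p \<in> arr C. F1 (vid C p) = vid D (F0 p)) \<and>
     (\<forall>p q r. \<forall>\<alpha> \<in> cell C p q. \<forall>\<beta> \<in> cell C q r. F1 (vcomp C \<beta> \<alpha>) = vcomp D (F1 \<beta>) (F1 \<alpha>))"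

definition transformation ::
  "flavour \<Rightarrow> 'x set \<Rightarrow> ('x, 'p, 'c) cat_multicat \<Rightarrow> ('x, 'q, 'd) cat_multicat \<Rightarrow>
   ('p \<Rightarrow> 'q) \<Rightarrow> ('c \<Rightarrow> 'd) \<Rightarrow> ('p \<Rightarrow> 'q) \<Rightarrow> ('c \<Rightarrow> 'd) \<Rightarrow> ('p \<Rightarrow> 'd) \<Rightarrow> bool" where
  "transformation k X C D F0 F1 G0 G1 \<eta> \<longleftrightarrow>
     (\<forall>p \<in> arr C. \<eta> p \<in> cell D (F0 p) (G0 p)) \<and>
     (\<forall>p q. \<forall>\<alpha> \<in> cell C p q. vcomp D (\<eta> q) (F1 \<alpha>) = vcomp D (G1 \<alpha>) (\<eta> p)) \<and>
     (\<forall>p ps. composable C p ps \<longrightarrow> \<eta> (mcomp C p ps) = cmcomp D (\<eta> p) (map \<eta> ps)) \<and>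
     (\<forall>x \<in> X. \<eta> (idn C x) = vid D (idn D x)) \<and>
     (k = Symmetric \<longrightarrow> (\<forall>p \<in> arr C. \<forall>\<sigma>. \<sigma> permutes {..<length (inp C p)} \<longrightarrow>
        \<eta> (act C \<sigma> p) = cact D \<sigma> (\<eta> p)))"

definition isomorphic_maps ::
  "flavour \<Rightarrow> 'x set \<Rightarrow> ('x, 'p, 'c) cat_multicat \<Rightarrow> ('x, 'q, 'd) cat_multicat \<Rightarrow>
   ('p \<Rightarrow> 'q) \<Rightarrow> ('c \<Rightarrow> 'd) \<Rightarrow> ('p \<Rightarrow> 'q) \<Rightarrow> ('c \<Rightarrow> 'd) \<Rightarrow> bool" where
  "isomorphic_maps k X C D F0 F1 G0 G1 \<longleftrightarrow>
     (\<exists>\<eta> \<theta>. transformation k X C D F0 F1 G0 G1 \<eta> \<and> transformation k X C D G0 G1 F0 F1 \<theta> \<and>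
       (\<forall>p \<in> arr C. vcomp D (\<theta> p) (\<eta> p) = vid D (F0 p) \<and> vcomp D (\<eta> p) (\<theta> p) = vid D (G0 p)))"

definition cat_equivalent ::
  "flavour \<Rightarrow> 'x set \<Rightarrow> ('x, 'p, 'c) cat_multicat \<Rightarrow> ('x, 'q, 'd) cat_multicat \<Rightarrow> bool" where
  "cat_equivalent k X C D \<longleftrightarrow>
     (\<exists>F0 F1 G0 G1. cat_multicat_map k X C D F0 F1 \<and> cat_multicat_map k X D C G0 G1 \<and>
       isomorphic_maps k X C C id id (G0 \<circ> F0) (G1 \<circ> F1) \<and>
       isomorphic_maps k X D D (F0 \<circ> G0) (F1 \<circ> G1) id id)"

definition discrete :: "('x, 'm) multicat \<Rightarrow> ('x, 'm, 'm) cat_multicat" where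
  "discrete M =
    \<lparr>arr = arr M, inp = inp M, out = out M, idn = idn M, mcomp = mcomp M, act = act M,
     cells = arr M, src = id, tgt = id, vid = id, vcomp = (\<lambda>_ m. m),
     cmcomp = mcomp M, cact = act M\<rparr>"


section \<open>Weakenings\<close>

text \<open>\<open>W\<close> is the middle object of a factorization of the discrete image of \<open>\<phi> : A \<rightarrow> M\<close> into
  \<open>b\<close>, bijective on the objects of each hom-category, followed by \<open>f\<close>, full and faithful on each
  hom-category; this determines \<open>W\<close> up to isomorphism. \<open>weakening_wk\<close> below shows existence.\<close>

definition weakening ::
  "flavour \<Rightarrow> 'x set \<Rightarrow> ('x, 'a) multicat \<Rightarrow> ('x, 'm) multicat \<Rightarrow> ('a \<Rightarrow> 'm) \<Rightarrow>
   ('x, 'p, 'c) cat_multicat \<Rightarrow> bool" where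
  "weakening k X A M \<phi> W \<longleftrightarrow>
     cat_multicategory k X W \<and>
     (\<exists>b0 b1 f0 f1.
       cat_multicat_map k X (discrete A) W b0 b1 \<and>
       cat_multicat_map k X W (discrete M) f0 f1 \<and>
       (\<forall>a \<in> arr A. f0 (b0 a) = \<phi> a) \<and> (\<forall>a \<in> cells (discrete A). f1 (b1 a) = \<phi> a) \<and>
       (\<forall>xs x. bij_betw b0 (hom (discrete A) xs x) (hom W xs x)) \<and>
       (\<forall>xs x. \<forall>p \<in> hom W xs x. \<forall>q \<in> hom W xs x.
          bij_betw f1 (cell W p q) (cell (discrete M) (f0 p) (f0 q))))"

definition unbiased_weakening ::
  "flavour \<Rightarrow> 'x set \<Rightarrow> ('x, 'm) multicat \<Rightarrow> ('x, 'p, 'c) cat_multicat \<Rightarrow> bool" where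
  "unbiased_weakening k X M W \<longleftrightarrow> weakening k X (free k X (forget M)) M (counit M) W"


section \<open>Block permutations\<close>

lemma unflat_less:
  "m < sum_list ks \<Longrightarrow> unflat ks m = (i, j) \<Longrightarrow>
     i < length ks \<and> j < ks ! i \<and> m = sum_list (take i ks) + j"
proof (induction ks m arbitrary: i rule: unflat.induct)
  case (2 k ks m)
  show ?case
  proof (cases "m < k")
    case False
    obtain i' j' where eq: "unflat ks (m - k) = (i', j')" by fastforce
    with False 2(3) have "i = Suc i'" "j' = j" by auto
    with 2(1)[OF False _ , of i'] eq 2(2) False show ?thesis by simp linarith
  qed (use 2 in auto)
qed auto

lemma unflat_flat:
  "i < length ks \<Longrightarrow> j < ks ! i \<Longrightarrow> unflat ks (sum_list (take i ks) + j) = (i, j)"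
proof (induction ks arbitrary: i)
  case (Cons k ks)
  then show ?case by (cases i) (auto simp: add.assoc)
qed auto

lemma flat_less:
  "i < length ks \<Longrightarrow> j < ks ! i \<Longrightarrow> sum_list (take i ks) + j < sum_list (ks :: nat list)"
proof (induction ks arbitrary: i)
  case (Cons k ks)
  then show ?case by (cases i) (auto simp: add.assoc trans_less_add1)
qed auto

lemma concat_flat:
  "i < length yss \<Longrightarrow> j < length (yss ! i) \<Longrightarrow>
     concat yss ! (sum_list (take i (map length yss)) + j) = yss ! i ! j"
proof (induction yss arbitrary: i)
  case (Cons ys yss)
  then show ?case by (cases i) (auto simp: nth_append add.assoc)
qed auto

lemma flat_cases:
  assumes "m < sum_list (ks :: nat list)"
  obtains i j where "i < length ks" "j < ks ! i" "m = sum_list (take i ks) + j"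
  using unflat_less[OF assms] by (metis surj_pair)

lemma flat_inj:
  assumes "i < length (ks :: nat list)" "j < ks ! i" "i' < length ks" "j' < ks ! i'"
    "sum_list (take i ks) + j = sum_list (take i' ks) + j'"
  shows "i = i' \<and> j = j'"
  using unflat_flat[OF assms(1,2)] unflat_flat[OF assms(3,4)] assms(5) by (metis Pair_inject)

lemma permutes_initial_segmentI:
  assumes "\<And>m. m < n \<Longrightarrow> f m < n" "inj_on f {..<n}" "\<And>m. \<not> m < n \<Longrightarrow> f m = m"
  shows "f permutes {..<(n::nat)}"
proof (rule bij_imp_permutes)
  have "f ` {..<n} \<subseteq> {..<n}" using assms(1) by auto
  then show "bij_betw f {..<n} {..<n}"
    using assms(2) by (simp add: bij_betw_def endo_inj_surj)
qed (use assms(3) in auto)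

lemma permute_list_nth_image:
  assumes "\<sigma> permutes {..<length xs}" "i < length xs"
  shows "\<sigma> i < length xs" "permute_list (inv \<sigma>) xs ! \<sigma> i = xs ! i"
proof -
  show "\<sigma> i < length xs" using assms by (metis lessThan_iff permutes_in_image)
  then show "permute_list (inv \<sigma>) xs ! \<sigma> i = xs ! i"
    using assms by (simp add: permute_list_nth permutes_inv permutes_inverses)
qed

lemma block_perm_flat:
  assumes "i < length ks" "j < ks ! i"
  shows "block_perm \<sigma> ks (sum_list (take i ks) + j) =
    sum_list (take (\<sigma> i) (permute_list (inv \<sigma>) ks)) + j"
  using flat_less[OF assms] unflat_flat[OF assms] by (simp add: block_perm_def)

lemma sum_perm_flat:
  assumes "i < length ks" "j < ks ! i"
  shows "sum_perm \<sigma>s ks (sum_list (take i ks) + j) = sum_list (take i ks) + (\<sigma>s ! i) j"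
  using flat_less[OF assms] unflat_flat[OF assms] by (simp add: sum_perm_def)

lemma block_perm_permutes:
  assumes \<sigma>: "\<sigma> permutes {..<length ks}"
  shows "block_perm \<sigma> ks permutes {..<sum_list ks}"
proof (rule permutes_initial_segmentI)
  let ?ks = "permute_list (inv \<sigma>) ks"
  have sum: "sum_list ?ks = sum_list ks"
    using mset_permute_list[OF permutes_inv[OF \<sigma>]] by (metis sum_mset_sum_list)
  show "block_perm \<sigma> ks m < sum_list ks" if "m < sum_list ks" for m
    using that
  proof (cases rule: flat_cases)
    case (1 i j)
    then show ?thesis
      using flat_less[of "\<sigma> i" ?ks j] permute_list_nth_image[OF \<sigma>, of i]
      by (simp add: block_perm_flat sum)
  qed
  show "inj_on (block_perm \<sigma> ks) {..<sum_list ks}"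
  proof (rule inj_onI)
    fix m m' assume "m \<in> {..<sum_list ks}" "m' \<in> {..<sum_list ks}"
      and eq: "block_perm \<sigma> ks m = block_perm \<sigma> ks m'"
    then have "m < sum_list ks" "m' < sum_list ks" by auto
    then obtain i j i' j' where *: "i < length ks" "j < ks ! i" "m = sum_list (take i ks) + j"
      "i' < length ks" "j' < ks ! i'" "m' = sum_list (take i' ks) + j'"
      by (elim flat_cases) blast
    then have "\<sigma> i = \<sigma> i' \<and> j = j'"
      using flat_inj[of "\<sigma> i" ?ks j "\<sigma> i'" j'] permute_list_nth_image[OF \<sigma>] eq
      by (simp add: block_perm_flat)
    then show "m = m'" using * permutes_inj[OF \<sigma>] by (auto dest: injD)
  qed
qed (simp add: block_perm_def)

lemma permute_list_concat_block:
  assumes \<sigma>: "\<sigma> permutes {..<length yss}"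
  shows "permute_list (inv (block_perm \<sigma> (map length yss))) (concat yss) =
    concat (permute_list (inv \<sigma>) yss)"
proof -
  let ?ks = "map length yss" and ?yss = "permute_list (inv \<sigma>) yss"
  let ?\<tau> = "block_perm \<sigma> ?ks"
  have \<tau>: "?\<tau> permutes {..<length (concat yss)}"
    using block_perm_permutes[of \<sigma> ?ks] \<sigma> by (simp add: length_concat)
  have map: "map length ?yss = permute_list (inv \<sigma>) ?ks"
    using permutes_inv[OF \<sigma>] by (simp add: permute_list_map)
  have len: "length (concat ?yss) = length (concat yss)"
    using mset_permute_list[OF permutes_inv[OF \<sigma>]]
    by (metis length_concat mset_map sum_mset_sum_list)
  have "permute_list ?\<tau> (concat ?yss) = concat yss"
  proof (rule nth_equalityI)
    fix m assume "m < length (permute_list ?\<tau> (concat ?yss))"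
    then have m: "m < sum_list ?ks" by (metis len length_concat length_permute_list)
    then show "permute_list ?\<tau> (concat ?yss) ! m = concat yss ! m"
    proof (cases rule: flat_cases)
      case (1 i j)
      then have ij: "i < length yss" "j < length (yss ! i)" by auto
      have "permute_list ?\<tau> (concat ?yss) ! m = concat ?yss ! ?\<tau> m"
        by (rule permute_list_nth; unfold len) (use m \<tau> in \<open>simp_all add: length_concat\<close>)
      also have "?\<tau> m = sum_list (take (\<sigma> i) (map length ?yss)) + j"
        unfolding map using 1 block_perm_flat by blast
      also have "concat ?yss ! \<dots> = yss ! i ! j"
        using concat_flat[of "\<sigma> i" ?yss j] permute_list_nth_image[OF \<sigma>, of i] ij by simp
      also have "\<dots> = concat yss ! m" using concat_flat[OF ij] 1 by simp
      finally show ?thesis .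
    qed
  qed (metis len length_permute_list)
  then have "permute_list (inv ?\<tau>) (concat yss) = permute_list (?\<tau> \<circ> inv ?\<tau>) (concat ?yss)"
    using permute_list_compose[of "inv ?\<tau>" "concat ?yss" ?\<tau>] permutes_inv[OF \<tau>] len by simp
  then show ?thesis using permutes_inv_o(1)[OF \<tau>] by simp
qed

lemma sum_perm_permutes:
  assumes \<sigma>s: "list_all2 (\<lambda>\<sigma> k. \<sigma> permutes {..<k}) \<sigma>s ks"
  shows "sum_perm \<sigma>s ks permutes {..<sum_list ks}"
proof (rule permutes_initial_segmentI)
  have *: "(\<sigma>s ! i) j < ks ! i" "inj (\<sigma>s ! i)" if "i < length ks" "j < ks ! i" for i j
    using list_all2_nthD2[OF \<sigma>s that(1)] that(2)
    by (metis lessThan_iff permutes_in_image, metis permutes_inj)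
  show "sum_perm \<sigma>s ks m < sum_list ks" if "m < sum_list ks" for m
    using that
  proof (cases rule: flat_cases)
    case (1 i j)
    then show ?thesis using flat_less *(1) by (simp add: sum_perm_flat)
  qed
  show "inj_on (sum_perm \<sigma>s ks) {..<sum_list ks}"
  proof (rule inj_onI)
    fix m m' assume "m \<in> {..<sum_list ks}" "m' \<in> {..<sum_list ks}"
      and eq: "sum_perm \<sigma>s ks m = sum_perm \<sigma>s ks m'"
    then have "m < sum_list ks" "m' < sum_list ks" by auto
    then obtain i j i' j' where 1: "i < length ks" "j < ks ! i" "m = sum_list (take i ks) + j"
      "i' < length ks" "j' < ks ! i'" "m' = sum_list (take i' ks) + j'"
      by (elim flat_cases) blast
    then have "i = i' \<and> (\<sigma>s ! i) j = (\<sigma>s ! i') j'"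
      using flat_inj[of i ks "(\<sigma>s ! i) j" i' "(\<sigma>s ! i') j'"] * eq by (simp add: sum_perm_flat)
    then show "m = m'" using 1 *(2) by (auto dest: injD)
  qed
qed (simp add: sum_perm_def)

lemma permute_list_concat_sum:
  assumes \<sigma>s: "list_all2 (\<lambda>\<sigma> ys. \<sigma> permutes {..<length ys}) \<sigma>s yss"
  shows "permute_list (inv (sum_perm \<sigma>s (map length yss))) (concat yss) =
    concat (map2 (\<lambda>\<sigma>. permute_list (inv \<sigma>)) \<sigma>s yss)"
proof -
  let ?ks = "map length yss" and ?yss = "map2 (\<lambda>\<sigma>. permute_list (inv \<sigma>)) \<sigma>s yss"
  let ?\<tau> = "sum_perm \<sigma>s ?ks"
  have l: "length \<sigma>s = length yss" using \<sigma>s by (rule list_all2_lengthD)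
  have \<sigma>: "(\<sigma>s ! i) permutes {..<length (yss ! i)}" if "i < length yss" for i
    using list_all2_nthD2[OF \<sigma>s that] .
  have \<tau>: "?\<tau> permutes {..<length (concat yss)}"
    using sum_perm_permutes[of \<sigma>s ?ks] \<sigma>s by (simp add: length_concat list.rel_map)
  have map: "map length ?yss = ?ks"
    by (rule nth_equalityI) (use l in auto)
  then have len: "length (concat ?yss) = length (concat yss)"
    by (simp only: length_concat)
  have "permute_list ?\<tau> (concat ?yss) = concat yss"
  proof (rule nth_equalityI)
    fix m assume "m < length (permute_list ?\<tau> (concat ?yss))"
    then have m: "m < sum_list ?ks" by (metis len length_concat length_permute_list)
    then show "permute_list ?\<tau> (concat ?yss) ! m = concat yss ! m"
    proof (cases rule: flat_cases)
      case (1 i j)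
      then have ij: "i < length yss" "j < length (yss ! i)" by auto
      note im = permute_list_nth_image[OF \<sigma>[OF ij(1)] ij(2)]
      have "permute_list ?\<tau> (concat ?yss) ! m = concat ?yss ! ?\<tau> m"
        by (rule permute_list_nth; unfold len) (use m \<tau> in \<open>simp_all add: length_concat\<close>)
      also have "?\<tau> m = sum_list (take i (map length ?yss)) + (\<sigma>s ! i) j"
        unfolding map using 1 sum_perm_flat by blast
      also have "concat ?yss ! \<dots> = yss ! i ! j"
        using concat_flat[of i ?yss "(\<sigma>s ! i) j"] im ij l by simp
      also have "\<dots> = concat yss ! m" using concat_flat[OF ij] 1 by simp
      finally show ?thesis .
    qed
  qed (metis len length_permute_list)
  then have "permute_list (inv ?\<tau>) (concat yss) = permute_list (?\<tau> \<circ> inv ?\<tau>) (concat ?yss)"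
    using permute_list_compose[of "inv ?\<tau>" "concat ?yss" ?\<tau>] permutes_inv[OF \<tau>] len by simp
  then show ?thesis using permutes_inv_o(1)[OF \<tau>] by simp
qed


section \<open>The free multicategory is left adjoint to the forgetful functor\<close>

lemma hom_arr: "f \<in> hom M xs x \<Longrightarrow> f \<in> arr M"
  by (simp add: hom_def)

lemma multicat_map_typed:
  assumes "multicat_map k X M N h" "f \<in> arr M"
  shows "h f \<in> arr N" "inp N (h f) = inp M f" "out N (h f) = out M f"
  using assms by (auto simp: multicat_map_def multigraph_map_def hom_def)

lemma multicat_map_preserves:
  assumes "multicat_map k X M N h"
  shows "x \<in> X \<Longrightarrow> h (idn M x) = idn N x"
    and "composable M f fs \<Longrightarrow> h (mcomp M f fs) = mcomp N (h f) (map h fs)"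
    and "\<lbrakk>k = Symmetric; f \<in> arr M; \<sigma> permutes {..<length (inp M f)}\<rbrakk> \<Longrightarrow>
      h (act M \<sigma> f) = act N \<sigma> (h f)"
  using assms by (auto simp: multicat_map_def)

lemma multicat_map_composable:
  assumes h: "multicat_map k X M N h" and f: "composable M f fs"
  shows "composable N (h f) (map h fs)"
proof -
  have eq: "map (out N) (map h fs) = map (out M) fs"
    using f multicat_map_typed(3)[OF h] unfolding composable_def map_map
    by (intro map_cong) auto
  show ?thesis using f multicat_map_typed[OF h] unfolding composable_def eq by auto
qed

lemma multicat_map_comp:
  assumes g: "multicat_map k X M N g" and h: "multicat_map k X N P h"
  shows "multicat_map k X M P (h \<circ> g)"
  using multicat_map_typed[OF g] multicat_map_typed[OF h] multicat_map_preserves[OF g]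
    multicat_map_preserves[OF h] multicat_map_composable[OF g]
  by (auto simp: multicat_map_def multigraph_map_def hom_def)

lemma multicat_map_id: "multicat_map k X M M id"
  by (auto simp: multicat_map_def multigraph_map_def hom_def)

lemma terms_CompD:
  assumes "Comp t ts \<in> terms k X E"
  shows "t \<in> terms k X E" "set ts \<subseteq> terms k X E" "map (tout E) ts = tinp E t"
  using assms by (auto elim: terms.cases)

lemma terms_ActD:
  assumes "Act \<sigma> t \<in> terms k X E"
  shows "k = Symmetric" "t \<in> terms k X E" "\<sigma> permutes {..<length (tinp E t)}"
  using assms by (auto elim: terms.cases)

lemma terms_typed:
  "multigraph X E \<Longrightarrow> t \<in> terms k X E \<Longrightarrow> set (tinp E t) \<subseteq> X \<and> tout E t \<in> X"
proof (induction t)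
  case (Gen e)
  then show ?case by (auto simp: multigraph_def elim: terms.cases)
next
  case (Idn x)
  then show ?case by (auto elim: terms.cases)
next
  case (Comp t ts)
  then show ?case using terms_CompD[OF Comp.prems(2)] by fastforce
next
  case (Act \<sigma> t)
  then show ?case using terms_ActD[OF Act.prems(2)]
    by (metis permutes_inv set_permute_list tinp.simps(4) tout.simps(4))
qed

lemma concat_map_concat:
  "concat (map (\<lambda>us. concat (map f us)) uss) = concat (map f (concat uss))"
  by (induction uss) auto

lemma teq_typed:
  assumes E: "multigraph X E" and "teq k X E t u"
  shows "t \<in> terms k X E \<and> u \<in> terms k X E \<and> tinp E t = tinp E u \<and> tout E t = tout E u"
  using assms(2)
proof induction
  case (Comp_cong t ts u us)
  note D = terms_CompD[OF Comp_cong(1)]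
  have l: "length us = length ts" using Comp_cong(4) by (auto dest: list_all2_lengthD)
  have nth: "us ! i \<in> terms k X E \<and> tinp E (us ! i) = tinp E (ts ! i) \<and> tout E (us ! i) = tout E (ts ! i)"
    if "i < length ts" for i
    using list_all2_nthD[OF Comp_cong(4) that] by simp
  have eqs: "map (tinp E) us = map (tinp E) ts" "map (tout E) us = map (tout E) ts"
    by (rule nth_equalityI; use nth l in simp)+
  moreover have "\<forall>s \<in> set us. s \<in> terms k X E" using nth l by (metis in_set_conv_nth)
  ultimately have "Comp u us \<in> terms k X E"
    using Comp_cong(3) D(3) by (intro terms.Comp) auto
  then show ?case using Comp_cong eqs by simp
next
  case (Act_cong \<sigma> t u)
  then show ?case using terms_ActD[OF Act_cong(1)] by (auto intro: terms.Act)
next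
  case (Comp_Idn t)
  then have "set (tinp E t) \<subseteq> X" using terms_typed[OF E] by blast
  then have "Comp t (map Idn (tinp E t)) \<in> terms k X E"
    using Comp_Idn by (intro terms.Comp) (auto intro: terms.Idn simp: comp_def)
  then show ?case using Comp_Idn by (simp add: comp_def)
next
  case (Idn_Comp t)
  then have "Comp (Idn (tout E t)) [t] \<in> terms k X E"
    using terms_typed[OF E] by (intro terms.Comp) (auto intro: terms.Idn)
  then show ?case using Idn_Comp by simp
next
  case (Comp_assoc t ts uss)
  note D = terms_CompD[OF Comp_assoc(1)]
  have l: "length uss = length ts" using Comp_assoc(2) by (auto dest: list_all2_lengthD)
  have nth: "Comp (ts ! i) (uss ! i) \<in> terms k X E" if "i < length ts" for i
    using list_all2_nthD[OF Comp_assoc(2) that] .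
  have eq: "map (\<lambda>us. map (tout E) us) uss = map (tinp E) ts"
    by (rule nth_equalityI) (use l nth[THEN terms_CompD(3)] in auto)
  have uss: "\<forall>us \<in> set uss. set us \<subseteq> terms k X E"
    using nth terms_CompD(2) l by (metis in_set_conv_nth)
  have 1: "Comp (Comp t ts) (concat uss) \<in> terms k X E"
    using uss by (intro terms.Comp[OF Comp_assoc(1)]) (auto simp: map_concat eq)
  have "map (tout E) (map2 Comp ts uss) = map (tout E) ts"
    by (rule nth_equalityI) (use l in auto)
  then have 2: "Comp t (map2 Comp ts uss) \<in> terms k X E"
    using D nth l by (intro terms.Comp) (auto simp: set_zip)
  have "map (tinp E) (map2 Comp ts uss) = map (\<lambda>us. concat (map (tinp E) us)) uss"
    by (rule nth_equalityI) (use l in auto)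
  then show ?case using 1 2 by (simp add: concat_map_concat del: map_concat)
next
  case (Act_id t)
  then show ?case using terms_ActD[OF Act_id(1)] by (simp add: permute_list_id)
next
  case (Act_Act \<sigma> t \<tau>)
  note S = terms_ActD[OF Act_Act(1)] and T = terms_ActD[OF Act_Act(2)]
  have "inv (\<sigma> \<circ> \<tau>) = inv \<tau> \<circ> inv \<sigma>"
    by (rule o_inv_distrib) (use S T permutes_bij in blast)+
  moreover have "Act (\<sigma> \<circ> \<tau>) t \<in> terms k X E"
    using S T by (intro terms.Act permutes_compose)
  moreover have "Act \<sigma> (Act \<tau> t) \<in> terms k X E"
    using S by (intro terms.Act[OF _ Act_Act(2)]) auto
  ultimately show ?case using permute_list_compose[of "inv \<sigma>" "tinp E t"] permutes_inv[OF S(3)]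
    by (simp add: permute_list_compose permutes_inv S T)
next
  case (Comp_Act_left t ts \<sigma>)
  note D = terms_CompD[OF Comp_Act_left(1)] and S = terms_ActD[OF Comp_Act_left(2)]
  have l: "length (tinp E t) = length ts" using D(3) by (metis length_map)
  have \<sigma>: "\<sigma> permutes {..<length ts}" using S(3) l by simp
  note \<sigma>' = permutes_inv[OF \<sigma>]
  have "map (tout E) (permute_list (inv \<sigma>) ts) = tinp E (Act \<sigma> t)"
    using permute_list_map[OF \<sigma>', of "tout E"] D(3) by simp
  then have 1: "Comp (Act \<sigma> t) (permute_list (inv \<sigma>) ts) \<in> terms k X E"
    using D(2) \<sigma>' by (intro terms.Comp[OF Comp_Act_left(2)]) auto
  let ?\<tau> = "block_perm \<sigma> (map (length \<circ> tinp E) ts)"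
  have "?\<tau> permutes {..<length (tinp E (Comp t ts))}"
    using block_perm_permutes[of \<sigma> "map (length \<circ> tinp E) ts"] \<sigma> by (simp add: length_concat)
  then have 2: "Act ?\<tau> (Comp t ts) \<in> terms k X E"
    by (rule terms.Act[OF S(1) Comp_Act_left(1)])
  have "tinp E (Act ?\<tau> (Comp t ts)) = concat (permute_list (inv \<sigma>) (map (tinp E) ts))"
    using permute_list_concat_block[of \<sigma> "map (tinp E) ts"] \<sigma> by (simp add: comp_def)
  also have "\<dots> = tinp E (Comp (Act \<sigma> t) (permute_list (inv \<sigma>) ts))"
    using \<sigma>' by (simp add: permute_list_map)
  finally show ?case using 1 2 by simp
next
  case (Comp_Act_right t ts \<sigma>s)
  note D = terms_CompD[OF Comp_Act_right(2)]
  have l: "length \<sigma>s = length ts" using Comp_Act_right(3) by (auto dest: list_all2_lengthD)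
  have nth: "Act (\<sigma>s ! i) (ts ! i) \<in> terms k X E" if "i < length ts" for i
    using list_all2_nthD2[OF Comp_Act_right(3) that] .
  have \<sigma>s: "list_all2 (\<lambda>\<sigma> ys. \<sigma> permutes {..<length ys}) \<sigma>s (map (tinp E) ts)"
    using Comp_Act_right(3) by (auto simp: list.rel_map elim!: list_all2_mono dest: terms_ActD)
  have "map (tout E) (map2 Act \<sigma>s ts) = map (tout E) ts"
    by (rule nth_equalityI) (use l in auto)
  then have 1: "Comp t (map2 Act \<sigma>s ts) \<in> terms k X E"
    using D nth l by (intro terms.Comp) (auto simp: set_zip)
  let ?\<tau> = "sum_perm \<sigma>s (map (length \<circ> tinp E) ts)"
  have "?\<tau> permutes {..<length (tinp E (Comp t ts))}"
    using sum_perm_permutes[of \<sigma>s "map (length \<circ> tinp E) ts"] \<sigma>s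
    by (simp add: length_concat list.rel_map)
  then have 2: "Act ?\<tau> (Comp t ts) \<in> terms k X E"
    by (rule terms.Act[OF Comp_Act_right(1,2)])
  have "tinp E (Act ?\<tau> (Comp t ts)) =
      concat (map2 (\<lambda>\<sigma>. permute_list (inv \<sigma>)) \<sigma>s (map (tinp E) ts))"
    using permute_list_concat_sum[OF \<sigma>s] by (simp add: comp_def)
  also have "map2 (\<lambda>\<sigma>. permute_list (inv \<sigma>)) \<sigma>s (map (tinp E) ts) =
      map (tinp E) (map2 Act \<sigma>s ts)"
    by (rule nth_equalityI) (use l in auto)
  finally show ?case using 1 2 by (simp add: comp_def)
qed auto

context
  fixes k :: flavour and X :: "'x set" and E :: "('x, 'e) multigraph"
  assumes E: "multigraph X E"
begin

lemma tclass_eq_iff: 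
  assumes "t \<in> terms k X E"
  shows "tclass k X E t = tclass k X E u \<longleftrightarrow> teq k X E t u"
  using teq.refl[OF assms] unfolding tclass_def by (blast intro: teq.sym teq.trans)

lemma tclass_eqI: "teq k X E t u \<Longrightarrow> tclass k X E t = tclass k X E u"
  using teq_typed[OF E] tclass_eq_iff by metis

lemma teq_rep: "t \<in> terms k X E \<Longrightarrow> teq k X E (rep (tclass k X E t)) t"
  using teq.refl unfolding rep_def tclass_def by (metis mem_Collect_eq someI teq.sym)

lemma rep_typed:
  assumes "t \<in> terms k X E"
  shows "rep (tclass k X E t) \<in> terms k X E"
    "tinp E (rep (tclass k X E t)) = tinp E t" "tout E (rep (tclass k X E t)) = tout E t"
  using teq_typed[OF E teq_rep[OF assms]] by auto

lemma free_arr: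
  assumes "c \<in> arr (free k X E)"
  shows "rep c \<in> terms k X E" "tclass k X E (rep c) = c"
proof -
  obtain t where "t \<in> terms k X E" "c = tclass k X E t" using assms by (auto simp: free_def)
  then show "rep c \<in> terms k X E" "tclass k X E (rep c) = c"
    using rep_typed teq_rep tclass_eqI by auto
qed

lemma tclass_arr: "t \<in> terms k X E \<Longrightarrow> tclass k X E t \<in> arr (free k X E)"
  by (simp add: free_def)

lemma tclass_hom: "t \<in> terms k X E \<Longrightarrow> tclass k X E t \<in> hom (free k X E) (tinp E t) (tout E t)"
  using rep_typed by (simp add: free_def hom_def)

lemma free_composable:
  assumes "composable (free k X E) c cs"
  shows "Comp (rep c) (map rep cs) \<in> terms k X E"
  using assms free_arr(1)
  by (intro terms.Comp) (auto simp: composable_def free_def comp_def)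

lemma free_mcomp_tclass:
  assumes "Comp t ts \<in> terms k X E"
  shows "mcomp (free k X E) (tclass k X E t) (map (tclass k X E) ts) = tclass k X E (Comp t ts)"
proof -
  note D = terms_CompD[OF assms]
  have "teq k X E (ts ! i) (rep (tclass k X E (ts ! i)))" if "i < length ts" for i
    using D(2) that by (meson nth_mem subsetD teq.sym teq_rep)
  then have "teq k X E (Comp t ts) (Comp (rep (tclass k X E t)) (map (rep \<circ> tclass k X E) ts))"
    using D(1) assms teq.sym[OF teq_rep]
    by (intro teq.Comp_cong) (auto simp: list_all2_conv_all_nth)
  then show ?thesis using tclass_eqI by (simp add: free_def)
qed

lemma free_act_tclass:
  assumes "Act \<sigma> t \<in> terms k X E"
  shows "act (free k X E) \<sigma> (tclass k X E t) = tclass k X E (Act \<sigma> t)"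
  using tclass_eqI[OF teq.Act_cong[OF assms teq.sym[OF teq_rep]]] terms_ActD[OF assms]
  by (simp add: free_def)

lemma free_list:
  "set cs \<subseteq> arr (free k X E) \<Longrightarrow> map (tclass k X E) (map rep cs) = cs"
  using free_arr(2) by (auto intro!: map_idI)

lemma free_inp: "inp (free k X E) c = tinp E (rep c)"
  and free_out: "out (free k X E) c = tout E (rep c)"
  and free_idn: "idn (free k X E) x = tclass k X E (Idn x)"
  and free_mcomp: "mcomp (free k X E) c cs = tclass k X E (Comp (rep c) (map rep cs))"
  and free_act: "act (free k X E) \<sigma> c = tclass k X E (Act \<sigma> (rep c))"
  by (simp_all add: free_def)

lemma free_act_term:
  "\<lbrakk>k = Symmetric; c \<in> arr (free k X E); \<sigma> permutes {..<length (inp (free k X E) c)}\<rbrakk> \<Longrightarrow>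
     Act \<sigma> (rep c) \<in> terms k X E"
  using free_arr(1) terms.Act unfolding free_inp by blast

lemma multicategory_free: "multicategory k X (free k X E)"
proof
  show "multigraph X (free k X E)"
    using free_arr(1) terms_typed[OF E] by (auto simp: multigraph_def free_inp free_out)
next
  fix x assume "x \<in> X"
  then show "idn (free k X E) x \<in> hom (free k X E) [x] x"
    using tclass_hom[OF terms.Idn] by (simp add: free_idn)
next
  fix c cs assume "composable (free k X E) c cs"
  from tclass_hom[OF free_composable[OF this]]
  show "mcomp (free k X E) c cs \<in>
      hom (free k X E) (concat (map (inp (free k X E)) cs)) (out (free k X E) c)"
    by (simp add: free_mcomp free_inp free_out comp_def cong: map_cong)
next
  fix c assume c: "c \<in> arr (free k X E)"
  let ?ts = "map Idn (tinp E (rep c))"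
  have eq: "teq k X E (Comp (rep c) ?ts) (rep c)"
    using free_arr(1)[OF c] by (rule teq.Comp_Idn)
  then have "Comp (rep c) ?ts \<in> terms k X E" using teq_typed[OF E] by blast
  note mc = free_mcomp_tclass[OF this]
  have "map (idn (free k X E)) (inp (free k X E) c) = map (tclass k X E) ?ts"
    by (simp add: free_inp free_idn)
  then show "mcomp (free k X E) c (map (idn (free k X E)) (inp (free k X E) c)) = c"
    using mc tclass_eqI[OF eq] free_arr(2)[OF c] by simp
next
  fix c assume c: "c \<in> arr (free k X E)"
  have eq: "teq k X E (Comp (Idn (tout E (rep c))) [rep c]) (rep c)"
    using free_arr(1)[OF c] by (rule teq.Idn_Comp)
  then have "Comp (Idn (tout E (rep c))) [rep c] \<in> terms k X E" using teq_typed[OF E] by blast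
  from free_mcomp_tclass[OF this] show "mcomp (free k X E) (idn (free k X E) (out (free k X E) c)) [c] = c"
    using tclass_eqI[OF eq] free_arr(2)[OF c] by (simp add: free_out free_idn)
next
  fix c cs dss
  assume c: "composable (free k X E) c cs" and ds: "list_all2 (composable (free k X E)) cs dss"
  let ?t = "rep c" and ?ts = "map rep cs" and ?uss = "map (map rep) dss"
  let ?C = "tclass k X E"
  have t: "Comp ?t ?ts \<in> terms k X E" using free_composable[OF c] .
  have uss: "list_all2 (\<lambda>s us. Comp s us \<in> terms k X E) ?ts ?uss"
    using ds by (auto simp: list.rel_map elim!: list_all2_mono dest: free_composable)
  have l: "length dss = length cs" using ds by (auto dest: list_all2_lengthD)
  have "set d \<subseteq> arr (free k X E)" if "d \<in> set dss" for d
    using that list_all2_nthD2[OF ds] by (metis composable_def in_set_conv_nth)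
  then have dss: "set (concat dss) \<subseteq> arr (free k X E)" by auto
  note eq = teq.Comp_assoc[OF t uss]
  have in1: "Comp (Comp ?t ?ts) (concat ?uss) \<in> terms k X E"
    and in2: "Comp ?t (map2 Comp ?ts ?uss) \<in> terms k X E"
    using teq_typed[OF E eq] by auto
  have "mcomp (free k X E) (mcomp (free k X E) c cs) (concat dss) =
      mcomp (free k X E) (?C (Comp ?t ?ts)) (map ?C (concat ?uss))"
    using free_list[OF dss] by (simp add: free_mcomp map_concat[symmetric])
  also have "\<dots> = ?C (Comp (Comp ?t ?ts) (concat ?uss))" by (rule free_mcomp_tclass[OF in1])
  also have "\<dots> = ?C (Comp ?t (map2 Comp ?ts ?uss))" by (rule tclass_eqI[OF eq])
  also have "\<dots> = mcomp (free k X E) (?C ?t) (map ?C (map2 Comp ?ts ?uss))"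
    by (rule free_mcomp_tclass[OF in2, symmetric])
  also have "map ?C (map2 Comp ?ts ?uss) = map2 (mcomp (free k X E)) cs dss"
    by (rule nth_equalityI) (use l in \<open>auto simp: free_mcomp\<close>)
  also have "?C ?t = c" using c free_arr(2) by (simp add: composable_def)
  finally show "mcomp (free k X E) (mcomp (free k X E) c cs) (concat dss) =
    mcomp (free k X E) c (map2 (mcomp (free k X E)) cs dss)" .
next
  fix c \<sigma> assume "k = Symmetric" "c \<in> arr (free k X E)" "\<sigma> permutes {..<length (inp (free k X E) c)}"
  then have "Act \<sigma> (rep c) \<in> terms k X E" by (rule free_act_term)
  from tclass_hom[OF this] show "act (free k X E) \<sigma> c \<in>
      hom (free k X E) (permute_list (inv \<sigma>) (inp (free k X E) c)) (out (free k X E) c)"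
    by (simp add: free_inp free_out free_act)
next
  fix c assume "k = Symmetric" and c: "c \<in> arr (free k X E)"
  then have "Act id (rep c) \<in> terms k X E"
    by (intro free_act_term) (simp_all add: permutes_id)
  then show "act (free k X E) id c = c"
    using tclass_eqI[OF teq.Act_id] free_arr(2)[OF c] by (simp add: free_act)
next
  fix c \<sigma> \<tau> assume "k = Symmetric" and c: "c \<in> arr (free k X E)"
    and "\<sigma> permutes {..<length (inp (free k X E) c)}" "\<tau> permutes {..<length (inp (free k X E) c)}"
  then have A: "Act \<sigma> (rep c) \<in> terms k X E" "Act \<tau> (rep c) \<in> terms k X E"
    using free_act_term by blast+
  note eq = teq.Act_Act[OF A]
  have "Act \<sigma> (Act \<tau> (rep c)) \<in> terms k X E" using teq_typed[OF E eq] by blast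
  from free_act_tclass[OF this]
  show "act (free k X E) (\<sigma> \<circ> \<tau>) c = act (free k X E) \<sigma> (act (free k X E) \<tau> c)"
    using tclass_eqI[OF eq] by (simp add: free_act)
next
  fix c cs \<sigma> assume k: "k = Symmetric" and c: "composable (free k X E) c cs"
    and \<sigma>: "\<sigma> permutes {..<length (inp (free k X E) c)}"
  let ?t = "rep c" and ?ts = "map rep cs" and ?C = "tclass k X E"
  have c': "c \<in> arr (free k X E)" "set cs \<subseteq> arr (free k X E)"
    and l: "length (inp (free k X E) c) = length cs"
    using c by (auto simp: composable_def) (metis length_map)
  have t: "Comp ?t ?ts \<in> terms k X E" using free_composable[OF c] .
  have s: "Act \<sigma> ?t \<in> terms k X E"
    using k c'(1) \<sigma> by (rule free_act_term)
  note eq = teq.Comp_Act_left[OF t s]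
  have in1: "Comp (Act \<sigma> ?t) (permute_list (inv \<sigma>) ?ts) \<in> terms k X E"
    and in2: "Act (block_perm \<sigma> (map (length \<circ> tinp E) ?ts)) (Comp ?t ?ts) \<in> terms k X E"
    using teq_typed[OF E eq] by auto
  have "map ?C (permute_list (inv \<sigma>) ?ts) = permute_list (inv \<sigma>) cs"
    using \<sigma> l free_list[OF c'(2)] by (simp flip: permute_list_map add: permutes_inv)
  then show "mcomp (free k X E) (act (free k X E) \<sigma> c) (permute_list (inv \<sigma>) cs) =
      act (free k X E) (block_perm \<sigma> (map (length \<circ> inp (free k X E)) cs)) (mcomp (free k X E) c cs)"
    using free_mcomp_tclass[OF in1] free_act_tclass[OF in2] tclass_eqI[OF eq]
    by (simp add: free_mcomp free_act free_inp comp_def)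
next
  fix c cs \<sigma>s assume k: "k = Symmetric" and c: "composable (free k X E) c cs"
    and \<sigma>s: "list_all2 (\<lambda>\<sigma> g. \<sigma> permutes {..<length (inp (free k X E) g)}) \<sigma>s cs"
  let ?t = "rep c" and ?ts = "map rep cs" and ?C = "tclass k X E"
  have c': "c \<in> arr (free k X E)" "set cs \<subseteq> arr (free k X E)"
    using c by (auto simp: composable_def)
  have l: "length \<sigma>s = length cs" using \<sigma>s by (rule list_all2_lengthD)
  have t: "Comp ?t ?ts \<in> terms k X E" using free_composable[OF c] .
  have s: "list_all2 (\<lambda>\<sigma> s. Act \<sigma> s \<in> terms k X E) \<sigma>s ?ts"
    using \<sigma>s free_act_term[OF k] c'(2) by (simp add: list_all2_conv_all_nth subset_iff)
  note eq = teq.Comp_Act_right[OF k t s]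
  have in1: "Comp ?t (map2 Act \<sigma>s ?ts) \<in> terms k X E"
    and in2: "Act (sum_perm \<sigma>s (map (length \<circ> tinp E) ?ts)) (Comp ?t ?ts) \<in> terms k X E"
    using teq_typed[OF E eq] by auto
  have "map ?C (map2 Act \<sigma>s ?ts) = map2 (act (free k X E)) \<sigma>s cs"
    by (rule nth_equalityI) (use l in \<open>auto simp: free_act\<close>)
  then show "mcomp (free k X E) c (map2 (act (free k X E)) \<sigma>s cs) =
      act (free k X E) (sum_perm \<sigma>s (map (length \<circ> inp (free k X E)) cs)) (mcomp (free k X E) c cs)"
    using free_mcomp_tclass[OF in1] free_act_tclass[OF in2] tclass_eqI[OF eq] free_arr(2)[OF c'(1)]
    by (simp add: free_mcomp free_inp comp_def)
qed

lemma free_unit_map: "multigraph_map E (forget (free k X E)) (free_unit k X E)"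
  using tclass_hom[OF terms.Gen]
  by (auto simp: multigraph_map_def forget_def multigraph.truncate_def free_unit_def hom_def)

context
  fixes N :: "('x, 'n) multicat" and h :: "'e \<Rightarrow> 'n"
  assumes N: "multicategory k X N" and h: "multigraph_map E (forget N) h"
begin

interpretation N: multicategory k X N by (rule N)

lemma teval_hom:
  "t \<in> terms k X E \<Longrightarrow> teval N h t \<in> hom N (tinp E t) (tout E t)"
proof (induction t)
  case (Gen e)
  then have "e \<in> arr E" by (auto elim: terms.cases)
  then show ?case using h
    by (auto simp: multigraph_map_def forget_def multigraph.truncate_def hom_def)
next
  case (Idn x)
  then show ?case using N.idn_hom by (auto elim: terms.cases)
next
  case (Comp t ts)
  note D = terms_CompD[OF Comp.prems]
  have ts: "teval N h s \<in> hom N (tinp E s) (tout E s)" if "s \<in> set ts" for s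
    using that Comp.IH D by auto
  have t: "teval N h t \<in> hom N (tinp E t) (tout E t)" using Comp.IH D by auto
  have "map (out N) (map (teval N h) ts) = map (tout E) ts"
    and i: "map (inp N) (map (teval N h) ts) = map (tinp E) ts"
    using ts by (auto simp: hom_def)
  then have "composable N (teval N h t) (map (teval N h) ts)"
    using ts t D(3) by (auto simp: composable_def hom_def)
  from N.mcomp_hom[OF this] show ?case using t by (simp add: hom_def i del: map_map)
next
  case (Act \<sigma> t)
  note D = terms_ActD[OF Act.prems]
  have "teval N h t \<in> hom N (tinp E t) (tout E t)" using Act.IH D by auto
  then show ?case using N.act_hom[OF D(1), of "teval N h t" \<sigma>] D(3) by (simp add: hom_def)
qed

lemma teval_typed:
  assumes "t \<in> terms k X E"
  shows "teval N h t \<in> arr N" "inp N (teval N h t) = tinp E t" "out N (teval N h t) = tout E t"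
  using teval_hom[OF assms] by (auto simp: hom_def)

lemma teval_composable:
  assumes "Comp t ts \<in> terms k X E"
  shows "composable N (teval N h t) (map (teval N h) ts)"
proof -
  note D = terms_CompD[OF assms]
  have "map (out N) (map (teval N h) ts) = map (tout E) ts" using D(2) teval_typed by auto
  then show ?thesis using D teval_typed by (auto simp: composable_def)
qed

lemma teval_teq: "teq k X E t u \<Longrightarrow> teval N h t = teval N h u"
proof (induction rule: teq.induct)
  case (Comp_cong t ts u us)
  then have "map (teval N h) ts = map (teval N h) us"
    by (auto simp: list_all2_conv_all_nth intro: nth_equalityI)
  then show ?case using Comp_cong by simp
next
  case (Comp_Idn t)
  then show ?case using N.mcomp_idn[of "teval N h t"] teval_typed by (simp add: comp_def)
next
  case (Idn_Comp t)
  then show ?case using N.idn_mcomp[of "teval N h t"] teval_typed by simp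
next
  case (Comp_assoc t ts uss)
  have "list_all2 (composable N) (map (teval N h) ts) (map (map (teval N h)) uss)"
    using Comp_assoc(2) by (auto simp: list.rel_map elim!: list_all2_mono dest: teval_composable)
  moreover have "map (teval N h) (map2 Comp ts uss) =
      map2 (mcomp N) (map (teval N h) ts) (map (map (teval N h)) uss)"
    by (rule nth_equalityI) (use list_all2_lengthD[OF Comp_assoc(2)] in auto)
  ultimately show ?case
    using N.mcomp_assoc[OF teval_composable[OF Comp_assoc(1)]] by (simp add: map_concat)
next
  case (Act_id t)
  then show ?case using N.act_id terms_ActD[OF Act_id] teval_typed by simp
next
  case (Act_Act \<sigma> t \<tau>)
  then show ?case using N.act_act terms_ActD[OF Act_Act(1)] terms_ActD[OF Act_Act(2)] teval_typed
    by simp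
next
  case (Comp_Act_left t ts \<sigma>)
  note D = terms_CompD[OF Comp_Act_left(1)] and S = terms_ActD[OF Comp_Act_left(2)]
  have l: "length (tinp E t) = length ts" using D(3) by (metis length_map)
  have len: "map (length \<circ> inp N) (map (teval N h) ts) = map (length \<circ> tinp E) ts"
    using D(2) teval_typed by auto
  moreover have "map (teval N h) (permute_list (inv \<sigma>) ts) =
      permute_list (inv \<sigma>) (map (teval N h) ts)"
    using permutes_inv[OF S(3)] l by (simp add: permute_list_map)
  ultimately show ?case
    using N.mcomp_act_left[OF S(1) teval_composable[OF Comp_Act_left(1)], of \<sigma>] S teval_typed(2)
    by (simp add: len del: map_map)
next
  case (Comp_Act_right t ts \<sigma>s)
  note D = terms_CompD[OF Comp_Act_right(2)]
  have l: "length \<sigma>s = length ts" using Comp_Act_right(3) by (rule list_all2_lengthD)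
  have len: "map (length \<circ> inp N) (map (teval N h) ts) = map (length \<circ> tinp E) ts"
    using D(2) teval_typed by auto
  moreover have "map (teval N h) (map2 Act \<sigma>s ts) = map2 (act N) \<sigma>s (map (teval N h) ts)"
    by (rule nth_equalityI) (use l in auto)
  moreover have "list_all2 (\<lambda>\<sigma> g. \<sigma> permutes {..<length (inp N g)}) \<sigma>s (map (teval N h) ts)"
    using Comp_Act_right(3) unfolding list.rel_map
  proof (rule list_all2_mono)
    fix \<sigma> s assume "Act \<sigma> s \<in> terms k X E"
    from terms_ActD[OF this] show "\<sigma> permutes {..<length (inp N (teval N h s))}"
      by (simp add: teval_typed(2))
  qed
  ultimately show ?case
    using N.mcomp_act_right[OF Comp_Act_right(1) teval_composable[OF Comp_Act_right(2)]]
    by (simp add: len del: map_map)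
qed auto

lemma free_ext_tclass: "t \<in> terms k X E \<Longrightarrow> free_ext N h (tclass k X E t) = teval N h t"
  using teval_teq[OF teq_rep] by (simp add: free_ext_def)

lemma free_ext_map: "multicat_map k X (free k X E) N (free_ext N h)"
  unfolding multicat_map_def
proof (intro conjI allI ballI impI)
  show "multigraph_map (free k X E) N (free_ext N h)"
    using free_arr(1) teval_hom by (auto simp: multigraph_map_def free_inp free_out free_ext_def)
next
  fix x assume "x \<in> X"
  then show "free_ext N h (idn (free k X E) x) = idn N x"
    by (simp add: free_idn free_ext_tclass terms.Idn)
next
  fix c cs assume "composable (free k X E) c cs"
  from free_ext_tclass[OF free_composable[OF this]]
  show "free_ext N h (mcomp (free k X E) c cs) = mcomp N (free_ext N h c) (map (free_ext N h) cs)"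
    by (simp add: free_mcomp free_ext_def[abs_def] comp_def)
next
  fix c \<sigma> assume "k = Symmetric" "c \<in> arr (free k X E)" "\<sigma> permutes {..<length (inp (free k X E) c)}"
  then have "Act \<sigma> (rep c) \<in> terms k X E" by (rule free_act_term)
  from free_ext_tclass[OF this]
  show "free_ext N h (act (free k X E) \<sigma> c) = act N \<sigma> (free_ext N h c)"
    by (simp add: free_act free_ext_def)
qed

lemma free_ext_unit: "e \<in> arr E \<Longrightarrow> free_ext N h (free_unit k X E e) = h e"
  by (simp add: free_unit_def free_ext_tclass terms.Gen)

lemma free_ext_unique:
  assumes g: "multicat_map k X (free k X E) N g"
    and gen: "\<And>e. e \<in> arr E \<Longrightarrow> g (free_unit k X E e) = h e"
    and c: "c \<in> arr (free k X E)"
  shows "g c = free_ext N h c"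
proof -
  have "t \<in> terms k X E \<Longrightarrow> g (tclass k X E t) = teval N h t" for t
  proof (induction t)
    case (Gen e)
    then have "e \<in> arr E" by (auto elim: terms.cases)
    then show ?case using gen by (simp add: free_unit_def)
  next
    case (Idn x)
    then have "x \<in> X" by (auto elim: terms.cases)
    then show ?case using g by (simp add: multicat_map_preserves(1)[OF g] flip: free_idn)
  next
    case (Comp t ts)
    note D = terms_CompD[OF Comp.prems]
    have "composable (free k X E) (tclass k X E t) (map (tclass k X E) ts)"
    proof -
      have "map (out (free k X E)) (map (tclass k X E) ts) = map (tout E) ts"
        using D(2) rep_typed(3) by (auto simp: free_out)
      then show ?thesis using D tclass_arr rep_typed(2) by (auto simp: composable_def free_inp)
    qed
    then have "g (tclass k X E (Comp t ts)) = mcomp N (g (tclass k X E t)) (map g (map (tclass k X E) ts))"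
      unfolding free_mcomp_tclass[OF Comp.prems, symmetric] by (rule multicat_map_preserves(2)[OF g])
    also have "map g (map (tclass k X E) ts) = map (teval N h) ts"
      using Comp.IH(2) D(2) by auto
    finally show ?case using Comp.IH(1) D(1) by simp
  next
    case (Act \<sigma> t)
    note D = terms_ActD[OF Act.prems]
    have "g (act (free k X E) \<sigma> (tclass k X E t)) = act N \<sigma> (g (tclass k X E t))"
      by (rule multicat_map_preserves(3)[OF g D(1) tclass_arr[OF D(2)]])
        (simp add: free_inp rep_typed(2)[OF D(2)] D(3))
    then show ?case using free_act_tclass[OF Act.prems] Act.IH D by simp
  qed
  from this[OF free_arr(1)[OF c]] show ?thesis by (simp add: free_arr(2)[OF c] free_ext_def)
qed

end

end


section \<open>Images and kernel pairs\<close>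

lemma multicategory_image:
  fixes M :: "('x, 'm) multicat" and N :: "('x, 'n) multicat"
  assumes M: "multicategory k X M" and h: "multicat_map k X M N h" and arr: "arr N = h ` arr M"
  shows "multicategory k X N"
proof -
  interpret M: multicategory k X M by (rule M)
  note ty = multicat_map_typed[OF h] and pres = multicat_map_preserves[OF h]
  have lift: "\<exists>fs'. composable M f fs' \<and> fs = map h fs'"
    if "f \<in> arr M" "composable N (h f) fs" for f fs
  proof -
    have "fs \<in> lists (h ` arr M)"
      using that(2) by (simp add: composable_def arr in_lists_conv_set subset_iff)
    then obtain fs' where fs': "set fs' \<subseteq> arr M" "fs = map h fs'"
      by (auto simp: lists_image in_lists_conv_set)
    then have "map (out N) fs = map (out M) fs'" using ty by auto
    then have "composable M f fs'" using that fs'(1) ty(2) by (simp add: composable_def)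
    then show ?thesis using fs'(2) by blast
  qed
  have lifts: "\<exists>gss'. list_all2 (composable M) fs gss' \<and> gss = map (map h) gss'"
    if "list_all2 (composable N) (map h fs) gss" "set fs \<subseteq> arr M" for fs gss
    using that
  proof (induction fs arbitrary: gss)
    case (Cons f fs)
    then obtain gs gss2 where *: "gss = gs # gss2" "composable N (h f) gs"
      "list_all2 (composable N) (map h fs) gss2" by (auto simp: list_all2_Cons1)
    obtain gs' where "composable M f gs'" "gs = map h gs'" using lift * Cons.prems by force
    moreover obtain gss' where "list_all2 (composable M) fs gss'" "gss2 = map (map h) gss'"
      using Cons.IH[OF *(3)] Cons.prems by auto
    ultimately have "list_all2 (composable M) (f # fs) (gs' # gss') \<and> gss = map (map h) (gs' # gss')"
      using * by simp
    then show ?case by blast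
  qed simp
  have mcomp_hom: "mcomp M f fs \<in> arr M" "out M (mcomp M f fs) = out M f"
    "inp M (mcomp M f fs) = concat (map (inp M) fs)" if "composable M f fs" for f fs
    using M.mcomp_hom[OF that] by (auto simp: hom_def)
  have inps: "map (inp N) (map h fs) = map (inp M) fs" if "set fs \<subseteq> arr M" for fs
    using that ty by auto
  show ?thesis
  proof
    show "multigraph X N" using M.graph ty by (auto simp: multigraph_def arr)
  next
    fix x assume x: "x \<in> X"
    then show "idn N x \<in> hom N [x] x"
      using M.idn_hom[OF x] ty[of "idn M x"] pres(1)[OF x] by (auto simp: hom_def)
  next
    fix f fs assume c: "composable N f fs"
    then obtain f' where f': "f' \<in> arr M" "f = h f'" by (auto simp: composable_def arr)
    with lift c obtain fs' where fs': "composable M f' fs'" "fs = map h fs'" by blast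
    then have "set fs' \<subseteq> arr M" by (simp add: composable_def)
    then show "mcomp N f fs \<in> hom N (concat (map (inp N) fs)) (out N f)"
      using mcomp_hom[OF fs'(1)] ty[of "mcomp M f' fs'"] pres(2)[OF fs'(1)] f' fs' inps ty[of f']
      by (simp add: hom_def del: map_map)
  next
    fix f assume "f \<in> arr N"
    then obtain f' where f': "f' \<in> arr M" "f = h f'" by (auto simp: arr)
    have X: "set (inp M f') \<subseteq> X" using M.graph f' by (auto simp: multigraph_def)
    have "map (out M) (map (idn M) (inp M f')) = inp M f'"
      using X M.idn_hom by (auto simp: hom_def intro!: map_idI)
    then have "composable M f' (map (idn M) (inp M f'))"
      using X M.idn_hom f' by (auto simp: composable_def hom_def)
    moreover have "map h (map (idn M) (inp M f')) = map (idn N) (inp N f)"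
      using X pres(1) f' ty by auto
    ultimately show "mcomp N f (map (idn N) (inp N f)) = f"
      using pres(2) M.mcomp_idn f' by metis
  next
    fix f assume "f \<in> arr N"
    then obtain f' where f': "f' \<in> arr M" "f = h f'" by (auto simp: arr)
    have X: "out M f' \<in> X" using M.graph f' by (auto simp: multigraph_def)
    then have "composable M (idn M (out M f')) [f']"
      using f' M.idn_hom by (auto simp: composable_def hom_def)
    from pres(2)[OF this] show "mcomp N (idn N (out N f)) [f] = f"
      using f' ty X pres(1) M.idn_mcomp by simp
  next
    fix f fs gss assume c: "composable N f fs" and cs: "list_all2 (composable N) fs gss"
    then obtain f' where f': "f' \<in> arr M" "f = h f'" by (auto simp: composable_def arr)
    with lift c obtain fs' where fs': "composable M f' fs'" "fs = map h fs'" by blast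
    then have sub: "set fs' \<subseteq> arr M" by (simp add: composable_def)
    with lifts cs fs' obtain gss' where gss': "list_all2 (composable M) fs' gss'"
      "gss = map (map h) gss'" by blast
    have len: "length gss' = length fs'" using gss'(1) by (auto dest: list_all2_lengthD)
    have nth: "composable M (fs' ! i) (gss' ! i)" if "i < length fs'" for i
      using list_all2_nthD[OF gss'(1) that] .
    have sub2: "set gs \<subseteq> arr M" if "gs \<in> set gss'" for gs
      using that nth len by (metis composable_def in_set_conv_nth)
    have "map (map (out M)) gss' = map (inp M) fs'"
      by (rule nth_equalityI) (use nth len in \<open>auto simp: composable_def\<close>)
    then have c1: "composable M (mcomp M f' fs') (concat gss')"
      using sub2 mcomp_hom[OF fs'(1)] by (auto simp: composable_def map_concat)
    have "map (out M) (map2 (mcomp M) fs' gss') = map (out M) fs'"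
      by (rule nth_equalityI) (use nth len mcomp_hom in auto)
    then have c2: "composable M f' (map2 (mcomp M) fs' gss')"
      using fs'(1) nth len mcomp_hom by (auto simp: composable_def set_zip)
    have "mcomp N (mcomp N f fs) (concat gss) = h (mcomp M (mcomp M f' fs') (concat gss'))"
      using pres(2)[OF c1] pres(2)[OF fs'(1)] f' fs' gss' by (simp add: map_concat)
    also have "\<dots> = h (mcomp M f' (map2 (mcomp M) fs' gss'))"
      using M.mcomp_assoc[OF fs'(1) gss'(1)] by simp
    also have "\<dots> = mcomp N f (map h (map2 (mcomp M) fs' gss'))"
      using pres(2)[OF c2] f' by simp
    also have "map h (map2 (mcomp M) fs' gss') = map2 (mcomp N) fs gss"
      by (rule nth_equalityI) (use nth len fs'(2) gss'(2) pres(2) in auto)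
    finally show "mcomp N (mcomp N f fs) (concat gss) = mcomp N f (map2 (mcomp N) fs gss)" .
  next
    fix f \<sigma> assume k: "k = Symmetric" and "f \<in> arr N" and \<sigma>: "\<sigma> permutes {..<length (inp N f)}"
    then obtain f' where f': "f' \<in> arr M" "f = h f'" by (auto simp: arr)
    then have \<sigma>: "\<sigma> permutes {..<length (inp M f')}" using ty \<sigma> by simp
    show "act N \<sigma> f \<in> hom N (permute_list (inv \<sigma>) (inp N f)) (out N f)"
      using M.act_hom[OF k f'(1) \<sigma>] ty[of "act M \<sigma> f'"] ty[of f'] pres(3)[OF k f'(1) \<sigma>] f'
      by (simp add: hom_def)
  next
    fix f assume k: "k = Symmetric" and "f \<in> arr N"
    then obtain f' where f': "f' \<in> arr M" "f = h f'" by (auto simp: arr)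
    show "act N id f = f"
      using M.act_id[OF k f'(1)] pres(3)[OF k f'(1) permutes_id] f' by simp
  next
    fix f \<sigma> \<tau> assume k: "k = Symmetric" and "f \<in> arr N"
      and p: "\<sigma> permutes {..<length (inp N f)}" "\<tau> permutes {..<length (inp N f)}"
    then obtain f' where f': "f' \<in> arr M" "f = h f'" by (auto simp: arr)
    then have p: "\<sigma> permutes {..<length (inp M f')}" "\<tau> permutes {..<length (inp M f')}"
      using ty p by simp_all
    have "act M \<tau> f' \<in> arr M" "length (inp M (act M \<tau> f')) = length (inp M f')"
      using M.act_hom[OF k f'(1) p(2)] by (auto simp: hom_def)
    then show "act N (\<sigma> \<circ> \<tau>) f = act N \<sigma> (act N \<tau> f)"
      using M.act_act[OF k f'(1) p] pres(3)[OF k f'(1) permutes_compose[OF p(2,1)]]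
        pres(3)[OF k f'(1) p(2)] pres(3)[OF k, of "act M \<tau> f'" \<sigma>] f' p by simp
  next
    fix f fs \<sigma> assume k: "k = Symmetric" and c: "composable N f fs"
      and \<sigma>: "\<sigma> permutes {..<length (inp N f)}"
    then obtain f' where f': "f' \<in> arr M" "f = h f'" by (auto simp: composable_def arr)
    with lift c obtain fs' where fs': "composable M f' fs'" "fs = map h fs'" by blast
    then have sub: "set fs' \<subseteq> arr M" and out: "map (out M) fs' = inp M f'"
      by (simp_all add: composable_def)
    then have len: "length (inp M f') = length fs'" by (metis length_map)
    have \<sigma>: "\<sigma> permutes {..<length (inp M f')}" using ty f' \<sigma> by simp
    then have \<sigma>': "inv \<sigma> permutes {..<length fs'}" using len permutes_inv by metis
    let ?\<tau> = "block_perm \<sigma> (map (length \<circ> inp M) fs')"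
    have ks: "map (length \<circ> inp N) fs = map (length \<circ> inp M) fs'"
      using sub ty fs'(2) by auto
    have a: "act M \<sigma> f' \<in> hom M (permute_list (inv \<sigma>) (inp M f')) (out M f')"
      using M.act_hom[OF k f'(1) \<sigma>] .
    then have c1: "composable M (act M \<sigma> f') (permute_list (inv \<sigma>) fs')"
      using sub \<sigma>' out permute_list_map[OF \<sigma>', of "out M"] by (simp add: composable_def hom_def)
    have "?\<tau> permutes {..<length (inp M (mcomp M f' fs'))}"
      using block_perm_permutes[of \<sigma> "map (length \<circ> inp M) fs'"] \<sigma> len mcomp_hom[OF fs'(1)]
      by (simp add: length_concat)
    then have "h (act M ?\<tau> (mcomp M f' fs')) = act N ?\<tau> (mcomp N f fs)"
      using pres(3)[OF k mcomp_hom(1)[OF fs'(1)]] pres(2)[OF fs'(1)] f' fs' by simp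
    moreover have "h (mcomp M (act M \<sigma> f') (permute_list (inv \<sigma>) fs')) =
        mcomp N (act N \<sigma> f) (permute_list (inv \<sigma>) fs)"
      using pres(2)[OF c1] pres(3)[OF k f'(1) \<sigma>] permute_list_map[OF \<sigma>', of h] f' fs' by simp
    ultimately show "mcomp N (act N \<sigma> f) (permute_list (inv \<sigma>) fs) =
        act N (block_perm \<sigma> (map (length \<circ> inp N) fs)) (mcomp N f fs)"
      unfolding ks using M.mcomp_act_left[OF k fs'(1) \<sigma>] by simp
  next
    fix f fs \<sigma>s assume k: "k = Symmetric" and c: "composable N f fs"
      and "list_all2 (\<lambda>\<sigma> g. \<sigma> permutes {..<length (inp N g)}) \<sigma>s fs"
    then obtain f' where f': "f' \<in> arr M" "f = h f'" by (auto simp: composable_def arr)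
    with lift c obtain fs' where fs': "composable M f' fs'" "fs = map h fs'" by blast
    then have sub: "set fs' \<subseteq> arr M" and out: "map (out M) fs' = inp M f'"
      by (simp_all add: composable_def)
    have \<sigma>s: "list_all2 (\<lambda>\<sigma> g. \<sigma> permutes {..<length (inp M g)}) \<sigma>s fs'"
      using \<open>list_all2 _ \<sigma>s fs\<close> sub ty(2) fs'(2)
      by (auto simp: list_all2_conv_all_nth subset_iff)
    have len: "length \<sigma>s = length fs'" using \<sigma>s by (rule list_all2_lengthD)
    have nth: "\<sigma>s ! i permutes {..<length (inp M (fs' ! i))}" "fs' ! i \<in> arr M" if "i < length fs'" for i
      using list_all2_nthD2[OF \<sigma>s that] sub that by auto
    let ?\<tau> = "sum_perm \<sigma>s (map (length \<circ> inp M) fs')"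
    have ks: "map (length \<circ> inp N) fs = map (length \<circ> inp M) fs'"
      using sub ty fs'(2) by auto
    have ah: "act M (\<sigma>s ! i) (fs' ! i) \<in> arr M" "out M (act M (\<sigma>s ! i) (fs' ! i)) = out M (fs' ! i)"
      if "i < length fs'" for i
      using M.act_hom[OF k nth(2,1)[OF that]] by (auto simp: hom_def)
    have "map (out M) (map2 (act M) \<sigma>s fs') = map (out M) fs'"
      by (rule nth_equalityI) (use len ah in auto)
    then have c1: "composable M f' (map2 (act M) \<sigma>s fs')"
      using f' out len ah by (auto simp: composable_def set_zip)
    have "?\<tau> permutes {..<length (inp M (mcomp M f' fs'))}"
      using sum_perm_permutes[of \<sigma>s "map (length \<circ> inp M) fs'"] \<sigma>s mcomp_hom[OF fs'(1)]
      by (simp add: length_concat list.rel_map)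
    then have "h (act M ?\<tau> (mcomp M f' fs')) = act N ?\<tau> (mcomp N f fs)"
      using pres(3)[OF k mcomp_hom(1)[OF fs'(1)]] pres(2)[OF fs'(1)] f' fs' by simp
    moreover have "map h (map2 (act M) \<sigma>s fs') = map2 (act N) \<sigma>s fs"
      by (rule nth_equalityI) (use len nth pres(3)[OF k] fs'(2) in auto)
    then have "h (mcomp M f' (map2 (act M) \<sigma>s fs')) = mcomp N f (map2 (act N) \<sigma>s fs)"
      using pres(2)[OF c1] f' by simp
    ultimately show "mcomp N f (map2 (act N) \<sigma>s fs) =
        act N (sum_perm \<sigma>s (map (length \<circ> inp N) fs)) (mcomp N f fs)"
      unfolding ks using M.mcomp_act_right[OF k fs'(1) \<sigma>s] by simp
  qed
qed

definition kernel_pair :: "('x, 'a) multicat \<Rightarrow> ('a \<Rightarrow> 'm) \<Rightarrow> ('x, 'a \<times> 'a) multicat" where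
  "kernel_pair A q =
    \<lparr>arr = {(a, b). a \<in> arr A \<and> b \<in> arr A \<and> inp A a = inp A b \<and> out A a = out A b \<and> q a = q b},
     inp = (\<lambda>p. inp A (fst p)), out = (\<lambda>p. out A (fst p)),
     idn = (\<lambda>x. (idn A x, idn A x)),
     mcomp = (\<lambda>p ps. (mcomp A (fst p) (map fst ps), mcomp A (snd p) (map snd ps))),
     act = (\<lambda>\<sigma> p. (act A \<sigma> (fst p), act A \<sigma> (snd p)))\<rparr>"

lemma map_fst_map2: "map fst (map2 (\<lambda>x y. (F x y, G x y)) xs ys) = map2 F xs ys"
  and map_snd_map2: "map snd (map2 (\<lambda>x y. (F x y, G x y)) xs ys) = map2 G xs ys"
  by (simp_all add: comp_def case_prod_beta)

lemma kernel_pair_composable: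
  assumes "composable (kernel_pair A q) p ps"
  shows "composable A (fst p) (map fst ps)" "composable A (snd p) (map snd ps)"
    "map (inp A) (map fst ps) = map (inp A) (map snd ps)" "map q (map fst ps) = map q (map snd ps)"
proof -
  have p: "fst p \<in> arr A" "snd p \<in> arr A" "inp A (fst p) = inp A (snd p)"
    and ps: "\<And>r. r \<in> set ps \<Longrightarrow> fst r \<in> arr A \<and> snd r \<in> arr A \<and> inp A (fst r) = inp A (snd r) \<and>
      out A (fst r) = out A (snd r) \<and> q (fst r) = q (snd r)"
    and o: "map (\<lambda>r. out A (fst r)) ps = inp A (fst p)"
    using assms by (auto simp: composable_def kernel_pair_def)
  have "map (\<lambda>r. out A (snd r)) ps = map (\<lambda>r. out A (fst r)) ps" using ps by simp
  with o p(3) have "map (\<lambda>r. out A (snd r)) ps = inp A (snd p)" by simp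
  with o p ps show "composable A (fst p) (map fst ps)" "composable A (snd p) (map snd ps)"
    by (auto simp: composable_def comp_def)
  show "map (inp A) (map fst ps) = map (inp A) (map snd ps)" "map q (map fst ps) = map q (map snd ps)"
    using ps by auto
qed

lemma kernel_pair:
  assumes A: "multicategory k X A" and q: "multicat_map k X A M q"
  shows "multicategory k X (kernel_pair A q)"
    and "multicat_map k X (kernel_pair A q) A fst" "multicat_map k X (kernel_pair A q) A snd"
proof -
  interpret A: multicategory k X A by (rule A)
  let ?K = "kernel_pair A q"
  note c = kernel_pair_composable and pres = multicat_map_preserves[OF q]
  have K: "arr ?K = {(a, b). a \<in> arr A \<and> b \<in> arr A \<and> inp A a = inp A b \<and> out A a = out A b \<and> q a = q b}"
    "inp ?K p = inp A (fst p)" "out ?K p = out A (fst p)" "idn ?K x = (idn A x, idn A x)"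
    "mcomp ?K p ps = (mcomp A (fst p) (map fst ps), mcomp A (snd p) (map snd ps))"
    "act ?K \<sigma> p = (act A \<sigma> (fst p), act A \<sigma> (snd p))" for p x ps \<sigma>
    by (simp_all add: kernel_pair_def)
  have K_arr: "p \<in> arr ?K \<longleftrightarrow> fst p \<in> arr A \<and> snd p \<in> arr A \<and> inp A (fst p) = inp A (snd p) \<and>
    out A (fst p) = out A (snd p) \<and> q (fst p) = q (snd p)" for p
    by (auto simp: K(1))
  have KI: "composable ?K p ps \<Longrightarrow> p \<in> arr ?K \<and> set ps \<subseteq> arr ?K" for p ps
    by (simp add: composable_def)
  show "multicat_map k X ?K A fst" "multicat_map k X ?K A snd"
    by (auto simp: multicat_map_def multigraph_map_def hom_def K)
  show "multicategory k X ?K"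
  proof
    show "multigraph X ?K" using A.graph by (auto simp: multigraph_def K)
  next
    fix x assume "x \<in> X"
    then show "idn ?K x \<in> hom ?K [x] x" using A.idn_hom by (auto simp: hom_def K)
  next
    fix p ps assume p: "composable ?K p ps"
    have "q (mcomp A (fst p) (map fst ps)) = q (mcomp A (snd p) (map snd ps))"
      using pres(2)[OF c(1)[OF p]] pres(2)[OF c(2)[OF p]] KI[OF p]
      by (simp add: K_arr c(4)[OF p] del: map_map)
    moreover have "map (inp ?K) ps = map (inp A) (map fst ps)" by (simp add: K)
    ultimately show "mcomp ?K p ps \<in> hom ?K (concat (map (inp ?K) ps)) (out ?K p)"
      using A.mcomp_hom[OF c(1)[OF p]] A.mcomp_hom[OF c(2)[OF p]] c(3)[OF p] KI[OF p]
      by (simp add: hom_def K_arr K(2-) del: map_map)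
  next
    fix p assume "p \<in> arr ?K"
    then show "mcomp ?K p (map (idn ?K) (inp ?K p)) = p"
      using A.mcomp_idn[of "fst p"] A.mcomp_idn[of "snd p"]
      by (simp add: K_arr K(2-) comp_def prod_eq_iff)
  next
    fix p assume "p \<in> arr ?K"
    then show "mcomp ?K (idn ?K (out ?K p)) [p] = p"
      using A.idn_mcomp[of "fst p"] A.idn_mcomp[of "snd p"]
      by (simp add: K_arr K(2-) prod_eq_iff)
  next
    fix p ps qss assume p: "composable ?K p ps" and qs: "list_all2 (composable ?K) ps qss"
    have 1: "list_all2 (composable A) (map fst ps) (map (map fst) qss)"
      and 2: "list_all2 (composable A) (map snd ps) (map (map snd) qss)"
      using qs c by (auto simp: list.rel_map elim!: list_all2_mono)
    have len: "length qss = length ps" using qs by (auto dest: list_all2_lengthD)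
    have "map fst (map2 (mcomp ?K) ps qss) = map2 (mcomp A) (map fst ps) (map (map fst) qss)"
      "map snd (map2 (mcomp ?K) ps qss) = map2 (mcomp A) (map snd ps) (map (map snd) qss)"
      by (rule nth_equalityI; use len in \<open>auto simp: K(5)\<close>)+
    then show "mcomp ?K (mcomp ?K p ps) (concat qss) = mcomp ?K p (map2 (mcomp ?K) ps qss)"
      using A.mcomp_assoc[OF c(1)[OF p] 1] A.mcomp_assoc[OF c(2)[OF p] 2]
      by (simp add: K(5) map_concat del: map_map)
  next
    fix p \<sigma> assume k: "k = Symmetric" and p: "p \<in> arr ?K" and \<sigma>: "\<sigma> permutes {..<length (inp ?K p)}"
    then have 1: "\<sigma> permutes {..<length (inp A (fst p))}" "\<sigma> permutes {..<length (inp A (snd p))}"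
      and 2: "fst p \<in> arr A" "snd p \<in> arr A"
      by (simp_all add: K_arr K(2))
    show "act ?K \<sigma> p \<in> hom ?K (permute_list (inv \<sigma>) (inp ?K p)) (out ?K p)"
      using A.act_hom[OF k 2(1) 1(1)] A.act_hom[OF k 2(2) 1(2)]
        pres(3)[OF k 2(1) 1(1)] pres(3)[OF k 2(2) 1(2)] p
      by (simp add: hom_def K_arr K(2-))
  next
    fix p assume k: "k = Symmetric" and p: "p \<in> arr ?K"
    then show "act ?K id p = p"
      using A.act_id[OF k] by (simp add: K_arr K(2-) prod_eq_iff)
  next
    fix p \<sigma> \<tau> assume k: "k = Symmetric" and p: "p \<in> arr ?K"
      and "\<sigma> permutes {..<length (inp ?K p)}" "\<tau> permutes {..<length (inp ?K p)}"
    then show "act ?K (\<sigma> \<circ> \<tau>) p = act ?K \<sigma> (act ?K \<tau> p)"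
      using A.act_act[OF k, of "fst p" \<sigma> \<tau>] A.act_act[OF k, of "snd p" \<sigma> \<tau>]
      by (simp add: K_arr K(2-))
  next
    fix p ps \<sigma> assume k: "k = Symmetric" and p: "composable ?K p ps"
      and \<sigma>: "\<sigma> permutes {..<length (inp ?K p)}"
    have "length (inp ?K p) = length ps" using p by (metis composable_def length_map)
    then have \<sigma>': "inv \<sigma> permutes {..<length ps}" using \<sigma> permutes_inv by metis
    have 1: "\<sigma> permutes {..<length (inp A (fst p))}" "\<sigma> permutes {..<length (inp A (snd p))}"
      using \<sigma> KI[OF p] by (simp_all add: K_arr K(2))
    have l: "map (length \<circ> inp ?K) ps = map (length \<circ> inp A) (map fst ps)"
      "map (length \<circ> inp ?K) ps = map (length \<circ> inp A) (map snd ps)"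
      using c(3)[OF p] by (auto simp: K(2))
    show "mcomp ?K (act ?K \<sigma> p) (permute_list (inv \<sigma>) ps) =
      act ?K (block_perm \<sigma> (map (length \<circ> inp ?K) ps)) (mcomp ?K p ps)"
      using A.mcomp_act_left[OF k c(1)[OF p] 1(1)] A.mcomp_act_left[OF k c(2)[OF p] 1(2)]
      unfolding l(1)[symmetric] l(2)[symmetric]
      by (simp add: K(5,6) permute_list_map[OF \<sigma>'])
  next
    fix p ps \<sigma>s assume k: "k = Symmetric" and p: "composable ?K p ps"
      and \<sigma>s: "list_all2 (\<lambda>\<sigma> g. \<sigma> permutes {..<length (inp ?K g)}) \<sigma>s ps"
    have len: "length \<sigma>s = length ps" using \<sigma>s by (rule list_all2_lengthD)
    have 1: "list_all2 (\<lambda>\<sigma> g. \<sigma> permutes {..<length (inp A g)}) \<sigma>s (map fst ps)"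
      using \<sigma>s by (simp add: list.rel_map K(2))
    moreover have "map (\<lambda>g. inp A (fst g)) ps = map (\<lambda>g. inp A (snd g)) ps"
      using c(3)[OF p] by simp
    ultimately have 2: "list_all2 (\<lambda>\<sigma> g. \<sigma> permutes {..<length (inp A g)}) \<sigma>s (map snd ps)"
      by (auto simp: list_all2_conv_all_nth)
    have l: "map (length \<circ> inp ?K) ps = map (length \<circ> inp A) (map fst ps)"
      "map (length \<circ> inp ?K) ps = map (length \<circ> inp A) (map snd ps)"
      using c(3)[OF p] by (auto simp: K(2))
    have "map fst (map2 (act ?K) \<sigma>s ps) = map2 (act A) \<sigma>s (map fst ps)"
      "map snd (map2 (act ?K) \<sigma>s ps) = map2 (act A) \<sigma>s (map snd ps)"
      by (rule nth_equalityI; use len in \<open>auto simp: K(6)\<close>)+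
    then show "mcomp ?K p (map2 (act ?K) \<sigma>s ps) =
      act ?K (sum_perm \<sigma>s (map (length \<circ> inp ?K) ps)) (mcomp ?K p ps)"
      using A.mcomp_act_right[OF k c(1)[OF p] 1] A.mcomp_act_right[OF k c(2)[OF p] 2]
      unfolding l(1)[symmetric] l(2)[symmetric]
      by (simp add: K(5,6) del: map_map)
  qed
qed


section \<open>Coequalizers do not depend on the test type, and weakenings exist\<close>

lemma multicat_image:
  fixes A :: "('x, 'a) multicat" and M :: "('x, 'm) multicat"
  assumes M: "multicategory k X A" and N: "multicategory k X M" and h: "multicat_map k X A M h"
  shows "multicategory k X (M\<lparr>arr := h ` arr A\<rparr>)" "multicat_map k X A (M\<lparr>arr := h ` arr A\<rparr>) h"
    "multicat_map k X (M\<lparr>arr := h ` arr A\<rparr>) M id"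
proof -
  have sub: "h ` arr A \<subseteq> arr M" using multicat_map_typed[OF h] by auto
  show map: "multicat_map k X A (M\<lparr>arr := h ` arr A\<rparr>) h"
    using multicat_map_typed[OF h] multicat_map_preserves[OF h]
    by (auto simp: multicat_map_def multigraph_map_def hom_def)
  show "multicategory k X (M\<lparr>arr := h ` arr A\<rparr>)"
    by (rule multicategory_image[OF M map]) simp
  show "multicat_map k X (M\<lparr>arr := h ` arr A\<rparr>) M id"
    using sub by (auto simp: multicat_map_def multigraph_map_def hom_def)
qed

definition transport :: "('m \<Rightarrow> 'n) \<Rightarrow> ('x, 'm) multicat \<Rightarrow> ('x, 'n) multicat" where
  "transport i M =
    \<lparr>arr = i ` arr M, inp = inp M \<circ> inv_into (arr M) i, out = out M \<circ> inv_into (arr M) i,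
     idn = i \<circ> idn M,
     mcomp = (\<lambda>f fs. i (mcomp M (inv_into (arr M) i f) (map (inv_into (arr M) i) fs))),
     act = (\<lambda>\<sigma> f. i (act M \<sigma> (inv_into (arr M) i f)))\<rparr>"

lemma transport:
  assumes M: "multicategory k X M" and i: "inj_on i (arr M)"
  shows "multicategory k X (transport i M)" "multicat_map k X M (transport i M) i"
    "multicat_map k X (transport i M) M (inv_into (arr M) i)"
proof -
  interpret M: multicategory k X M by (rule M)
  let ?j = "inv_into (arr M) i"
  have ji: "?j (i f) = f" if "f \<in> arr M" for f using i that by simp
  have jis: "map (?j \<circ> i) fs = fs" if "set fs \<subseteq> arr M" for fs
    using that ji by (auto intro!: map_idI)
  show map: "multicat_map k X M (transport i M) i"
    using ji jis
    by (auto simp: multicat_map_def multigraph_map_def hom_def transport_def composable_def)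
  show "multicategory k X (transport i M)"
    by (rule multicategory_image[OF M map]) (simp add: transport_def)
  have lift: "composable M (?j f) (map ?j fs)" if "composable (transport i M) f fs" for f fs
    using that ji by (auto simp: composable_def transport_def subset_iff comp_def)
  show "multicat_map k X (transport i M) M ?j"
    using ji M.idn_hom M.mcomp_hom[OF lift] M.act_hom
    by (auto simp: multicat_map_def multigraph_map_def hom_def transport_def)
qed

lemma coequalizer_test:
  fixes A :: "('x, 'a) multicat" and M :: "('x, 'm) multicat"
    and T :: "('x, 'b) multicat" and i :: "'b \<Rightarrow> 't"
  assumes co: "coequalizer TYPE('t) k X R f g A M q"
    and T: "multicategory k X T" and i: "inj_on i (arr T)"
    and h: "multicat_map k X A T h" and eq: "\<And>r. r \<in> arr R \<Longrightarrow> h (f r) = h (g r)"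
  shows "\<exists>u. multicat_map k X M T u \<and> (\<forall>a \<in> arr A. u (q a) = h a)"
    and "\<And>u v m. \<lbrakk>multicat_map k X M T u; \<forall>a \<in> arr A. u (q a) = h a;
      multicat_map k X M T v; \<forall>a \<in> arr A. v (q a) = h a; m \<in> arr M\<rbrakk> \<Longrightarrow> u m = v m"
proof -
  let ?T = "transport i T" and ?j = "inv_into (arr T) i"
  note tr = transport[OF T i]
  have ih: "multicat_map k X A ?T (i \<circ> h)" by (rule multicat_map_comp[OF h tr(2)])
  have "\<forall>r \<in> arr R. (i \<circ> h) (f r) = (i \<circ> h) (g r)" using eq by simp
  then have ex: "\<exists>u. multicat_map k X M ?T u \<and> (\<forall>a \<in> arr A. u (q a) = (i \<circ> h) a) \<and>
      (\<forall>v. multicat_map k X M ?T v \<and> (\<forall>a \<in> arr A. v (q a) = (i \<circ> h) a) \<longrightarrow> (\<forall>m \<in> arr M. v m = u m))"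
    using co tr(1) ih unfolding coequalizer_def by blast
  then obtain u where u: "multicat_map k X M ?T u" "\<forall>a \<in> arr A. u (q a) = (i \<circ> h) a"
    and uniq: "\<And>v m. \<lbrakk>multicat_map k X M ?T v; \<forall>a \<in> arr A. v (q a) = (i \<circ> h) a; m \<in> arr M\<rbrakk> \<Longrightarrow>
      v m = u m"
    by blast
  have "(?j \<circ> u) (q a) = h a" if "a \<in> arr A" for a
    using that u(2) i multicat_map_typed(1)[OF h] by simp
  then show "\<exists>u. multicat_map k X M T u \<and> (\<forall>a \<in> arr A. u (q a) = h a)"
    using multicat_map_comp[OF u(1) tr(3)] by blast
  fix v w m
  assume v: "multicat_map k X M T v" "\<forall>a \<in> arr A. v (q a) = h a"
    and w: "multicat_map k X M T w" "\<forall>a \<in> arr A. w (q a) = h a" and m: "m \<in> arr M"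
  have "(i \<circ> v) m = u m" using v m by (intro uniq[of "i \<circ> v"] multicat_map_comp[OF _ tr(2)]) simp_all
  moreover have "(i \<circ> w) m = u m" using w m by (intro uniq[of "i \<circ> w"] multicat_map_comp[OF _ tr(2)]) simp_all
  ultimately show "v m = w m"
    using i m multicat_map_typed(1)[OF v(1)] multicat_map_typed(1)[OF w(1)]
    by (metis comp_apply inj_onD)
qed

lemma coequalizer_surj:
  fixes A :: "('x, 'a) multicat" and M :: "('x, 'm) multicat"
  assumes co: "coequalizer TYPE('a + 'm) k X R f g A M q"
  shows "q ` arr A = arr M"
proof -
  have A: "multicategory k X A" and M: "multicategory k X M" and q: "multicat_map k X A M q"
    and eq: "\<And>r. r \<in> arr R \<Longrightarrow> q (f r) = q (g r)"
    using co by (auto simp: coequalizer_def)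
  let ?I = "M\<lparr>arr := q ` arr A\<rparr>" and ?i = "Inr :: 'm \<Rightarrow> 'a + 'm"
  note im = multicat_image[OF A M q]
  obtain u where u: "multicat_map k X M ?I u" "\<forall>a \<in> arr A. u (q a) = q a"
    using coequalizer_test(1)[OF co im(1) _ im(2) eq, of ?i] by auto
  have uM: "multicat_map k X M M u" using multicat_map_comp[OF u(1) im(3)] by simp
  have "u m = id m" if "m \<in> arr M" for m
    using that u(2) by (intro coequalizer_test(2)[OF co M _ q eq, of ?i] uM multicat_map_id) auto
  then have "m \<in> q ` arr A" if "m \<in> arr M" for m
    using that multicat_map_typed(1)[OF u(1) that] by simp
  then show ?thesis using multicat_map_typed(1)[OF q] by auto
qed

lemma coequalizer_any_type:
  fixes A :: "('x, 'a) multicat" and M :: "('x, 'm) multicat"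
  assumes co: "coequalizer TYPE('a + 'm) k X R f g A M q"
  shows "coequalizer TYPE('t) k X R f g A M q"
proof -
  have A: "multicategory k X A" and q: "multicat_map k X A M q"
    using co by (auto simp: coequalizer_def)
  have "\<exists>u. multicat_map k X M T u \<and> (\<forall>a \<in> arr A. u (q a) = h a) \<and>
      (\<forall>v. multicat_map k X M T v \<and> (\<forall>a \<in> arr A. v (q a) = h a) \<longrightarrow> (\<forall>m \<in> arr M. v m = u m))"
    if T: "multicategory k X T" and h: "multicat_map k X A T h"
      and eq: "\<forall>r \<in> arr R. h (f r) = h (g r)" for T :: "('x, 't) multicat" and h
  proof -
    let ?I = "T\<lparr>arr := h ` arr A\<rparr>" and ?i = "(Inl :: 'a \<Rightarrow> 'a + 'm) \<circ> inv_into (arr A) h"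
    note im = multicat_image[OF A T h]
    have "inj_on ?i (arr ?I)" by (simp add: comp_inj_on inj_on_inv_into)
    then obtain u where u: "multicat_map k X M ?I u" "\<forall>a \<in> arr A. u (q a) = h a"
      using coequalizer_test(1)[OF co im(1) _ im(2), of ?i] eq by blast
    have "multicat_map k X M T u" using multicat_map_comp[OF u(1) im(3)] by simp
    moreover have "\<forall>m \<in> arr M. v m = u m" if "\<forall>a \<in> arr A. v (q a) = h a" for v
      using that u(2) unfolding coequalizer_surj[OF co, symmetric] by simp
    ultimately show ?thesis using u(2) by blast
  qed
  then show ?thesis using co unfolding coequalizer_def by blast
qed

lemma regular_epiI:
  fixes A :: "('x, 'a) multicat" and M :: "('x, 'm) multicat"
  assumes co: "coequalizer TYPE('a + 'm) k X (R :: ('x, 'r) multicat) f g A M q"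
  shows "regular_epi k X A M q"
proof -
  have A: "multicategory k X A" and q: "multicat_map k X A M q" and M: "multicategory k X M"
    and f: "multicat_map k X R A f" and g: "multicat_map k X R A g"
    and eq: "\<forall>r \<in> arr R. q (f r) = q (g r)"
    using co by (auto simp: coequalizer_def)
  let ?K = "kernel_pair A q"
  note K = kernel_pair[OF A q]
  have arr: "(f r, g r) \<in> arr ?K" if "r \<in> arr R" for r
    using that eq multicat_map_typed[OF f that] multicat_map_typed[OF g that]
    by (simp add: kernel_pair_def)
  have qK: "\<forall>p \<in> arr ?K. q (fst p) = q (snd p)" by (auto simp: kernel_pair_def)
  have hR: "\<forall>r \<in> arr R. h (f r) = h (g r)" if "\<forall>p \<in> arr ?K. h (fst p) = h (snd p)"
    for h :: "'a \<Rightarrow> 'a + 'm"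
    using that arr by fastforce
  have "coequalizer TYPE('a + 'm) k X ?K fst snd A M q"
    using co K qK hR unfolding coequalizer_def by blast
  then show ?thesis unfolding regular_epi_def by blast
qed

lemma regular_epi_surj: "regular_epi k X A M q \<Longrightarrow> q ` arr A = arr M"
  using coequalizer_surj unfolding regular_epi_def by blast

definition wk :: "('x, 'a) multicat \<Rightarrow> ('a \<Rightarrow> 'm) \<Rightarrow> ('x, 'a, 'a \<times> 'a) cat_multicat" where
  "wk A q =
    \<lparr>arr = arr A, inp = inp A, out = out A, idn = idn A, mcomp = mcomp A, act = act A,
     cells = arr (kernel_pair A q), src = fst, tgt = snd, vid = (\<lambda>a. (a, a)),
     vcomp = (\<lambda>q p. (fst p, snd q)),
     cmcomp = mcomp (kernel_pair A q), cact = act (kernel_pair A q)\<rparr>"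

lemma multicategory_cong:
  fixes M :: "('x, 'm) multicat" and N :: "('x, 'm, 'z) multicat_scheme"
  assumes "multicategory k X M" "arr N = arr M" "inp N = inp M" "out N = out M" "idn N = idn M"
    "mcomp N = mcomp M" "act N = act M"
  shows "multicategory k X N"
  using assms unfolding multicategory_def multigraph_def composable_def hom_def by simp

lemma multicat_map_cong:
  assumes "multicat_map k X M N h"
    "arr M' = arr M" "inp M' = inp M" "out M' = out M" "idn M' = idn M" "mcomp M' = mcomp M" "act M' = act M"
    "arr N' = arr N" "inp N' = inp N" "out N' = out N" "idn N' = idn N" "mcomp N' = mcomp N" "act N' = act N"
  shows "multicat_map k X M' N' h"
  using assms unfolding multicat_map_def multigraph_map_def composable_def hom_def by simp

lemma weakening_wk:
  assumes A: "multicategory k X A" and M: "multicategory k X M" and q: "multicat_map k X A M q"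
  shows "weakening k X A M q (wk A q)"
proof -
  let ?W = "wk A q" and ?K = "kernel_pair A q"
  note K = kernel_pair[OF A q]
  have cm: "cell_multicat ?W = ?K" by (simp add: cell_multicat_def wk_def kernel_pair_def)
  have W: "arr ?W = arr A" "inp ?W = inp A" "out ?W = out A" "idn ?W = idn A" "mcomp ?W = mcomp A"
    "act ?W = act A"
    by (simp_all add: wk_def)
  have D: "arr (discrete N) = arr N" "inp (discrete N) = inp N" "out (discrete N) = out N"
    "idn (discrete N) = idn N" "mcomp (discrete N) = mcomp N" "act (discrete N) = act N"
    "cell_multicat (discrete N) = N" "cells (discrete N) = arr N" "src (discrete N) = id"
    "tgt (discrete N) = id" "vid (discrete N) = id" "vcomp (discrete N) \<beta> \<alpha> = \<alpha>" for \<alpha> \<beta> and N :: "('x, 'n) multicat"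
    by (simp_all add: discrete_def cell_multicat_def)
  have cell: "cell ?W a b = {p \<in> arr ?K. p = (a, b)}" for a b
    by (auto simp: cell_def wk_def)
  have dcell: "cell (discrete N) a b = {m \<in> arr N. m = a \<and> m = b}" for a b and N :: "('x, 'n) multicat"
    by (auto simp: cell_def discrete_def)
  have diag: "multicat_map k X A ?K (\<lambda>a. (a, a))"
    by (auto simp: multicat_map_def multigraph_map_def hom_def kernel_pair_def comp_def)
  have Karr: "(a, b) \<in> arr ?K \<longleftrightarrow> a \<in> arr A \<and> b \<in> arr A \<and> inp A a = inp A b \<and> out A a = out A b \<and> q a = q b"
    for a b by (simp add: kernel_pair_def)
  have ops: "cells ?W = arr ?K" "src ?W = fst" "tgt ?W = snd" "vid ?W a = (a, a)" "vcomp ?W \<beta> \<alpha> = (fst \<alpha>, snd \<beta>)"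
    "cmcomp ?W = mcomp ?K" "cact ?W = act ?K" for a \<alpha> \<beta>
    by (simp_all add: wk_def)
  have "cat_multicategory k X ?W"
  proof (rule cat_multicategory.intro)
    show "multicategory k X ?W" by (rule multicategory_cong[OF A]) (simp_all add: W)
    show "multicategory k X (cell_multicat ?W)" using K cm by simp
    show "multicat_map k X (cell_multicat ?W) ?W (src ?W)" unfolding cm ops
      by (rule multicat_map_cong[OF K(2)]) (simp_all add: W)
    show "multicat_map k X (cell_multicat ?W) ?W (tgt ?W)" unfolding cm ops
      by (rule multicat_map_cong[OF K(3)]) (simp_all add: W)
    show "multicat_map k X ?W (cell_multicat ?W) (vid ?W)" unfolding cm ops(4)[abs_def]
      by (rule multicat_map_cong[OF diag]) (simp_all add: W)
  next
    fix \<alpha> \<alpha>s \<beta> \<beta>s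
    assume "composable (cell_multicat ?W) \<alpha> \<alpha>s" "composable (cell_multicat ?W) \<beta> \<beta>s"
      "tgt ?W \<alpha> = src ?W \<beta>" and eq: "map (tgt ?W) \<alpha>s = map (src ?W) \<beta>s"
    have len: "length \<alpha>s = length \<beta>s" using eq by (metis length_map)
    have "map fst (map2 (vcomp ?W) \<beta>s \<alpha>s) = map fst \<alpha>s" "map snd (map2 (vcomp ?W) \<beta>s \<alpha>s) = map snd \<beta>s"
      by (rule nth_equalityI; use len in \<open>auto simp: ops\<close>)+
    then show "cmcomp ?W (vcomp ?W \<beta> \<alpha>) (map2 (vcomp ?W) \<beta>s \<alpha>s) =
        vcomp ?W (cmcomp ?W \<beta> \<beta>s) (cmcomp ?W \<alpha> \<alpha>s)"
      by (simp add: ops kernel_pair_def del: map_map)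
  qed (auto simp: cell ops Karr W kernel_pair_def)
  moreover have "cat_multicat_map k X (discrete A) ?W id (\<lambda>a. (a, a))"
    unfolding cat_multicat_map_def cm D(7)
    by (intro conjI diag multicat_map_cong[OF multicat_map_id[of k X A]])
      (auto simp: D W cell dcell ops Karr)
  moreover have "multicat_map k X ?K M (q \<circ> fst)" by (rule multicat_map_comp[OF K(2) q])
  then have "cat_multicat_map k X ?W (discrete M) q (q \<circ> fst)"
    unfolding cat_multicat_map_def cm D(7)
    by (intro conjI multicat_map_cong[OF q])
      (use multicat_map_typed(1)[OF q] in \<open>auto simp: D W cell dcell ops Karr\<close>)
  moreover have "bij_betw (q \<circ> fst) (cell ?W a b) (cell (discrete M) (q a) (q b))"
    if "a \<in> hom ?W xs x" "b \<in> hom ?W xs x" for a b xs x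
    using that multicat_map_typed(1)[OF q]
    by (cases "q a = q b") (auto simp: hom_def W D cell dcell Karr bij_betw_def inj_on_def)
  moreover have "bij_betw id (hom (discrete A) xs x) (hom ?W xs x)" for xs x
    by (simp add: hom_def D W)
  ultimately show ?thesis
    unfolding weakening_def by (intro conjI exI[of _ id] exI[of _ q] exI[of _ "q \<circ> fst"]
      exI[of _ "\<lambda>a. (a, a)"]) auto
qed

end

theory Submission
  imports Defs
begin

text \<open>A weakening of \<open>M\<close> has as its hom-categories preorders in which any two objects lying over
  the same arrow of \<open>M\<close> are uniquely isomorphic, and there are no other cells
  (\<open>weakening_indiscrete\<close>). In such a \<open>Cat\<close>-multicategory every equation between parallel cells
  holds automatically. Hence any map of underlying multicategories over \<open>M\<close> extends to the cells
  (\<open>lift_map\<close>), and any two maps that agree after projection to \<open>M\<close> are isomorphic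
  (\<open>isomorphic_over\<close>). So two of them are equivalent as soon as there are maps over \<open>M\<close> between
  their underlying multicategories, in both directions and without any condition on the round
  trips (\<open>equivalent_over\<close>).

  The underlying multicategory of a weakening is the domain of the map that is weakened, here a
  free multicategory. A regular epimorphism is surjective on arrows, and so is the counit, by a
  triangle identity. Free multicategories are projective with respect to maps that are surjective
  on arrows: it suffices to choose preimages of the generators (\<open>free_projective\<close>). This yields the
  two comparison maps.\<close>

section \<open>Cat-multicategories with indiscrete fibres over a multicategory\<close>

lemma cell_simps:
  "arr (cell_multicat C) = cells C" "inp (cell_multicat C) \<alpha> = inp C (src C \<alpha>)"
  "out (cell_multicat C) \<alpha> = out C (src C \<alpha>)" "idn (cell_multicat C) x = vid C (idn C x)"
  "mcomp (cell_multicat C) = cmcomp C" "act (cell_multicat C) = cact C"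
  by (simp_all add: cell_multicat_def)

context cat_multicategory
begin

lemma cell_typed:
  assumes "\<alpha> \<in> cell C p q"
  shows "p \<in> arr C" "q \<in> arr C" "inp C q = inp C p" "out C q = out C p"
    "\<alpha> \<in> cells C" "src C \<alpha> = p" "tgt C \<alpha> = q"
  using assms multicat_map_typed[OF src_map, of \<alpha>] multicat_map_typed[OF tgt_map, of \<alpha>]
  by (auto simp: cell_def cell_simps)

end

text \<open>That \<open>f\<close> is full and faithful on hom-categories, as a map to a discrete target, says exactly
  that each hom-category is the disjoint union of the indiscrete categories on the fibres of \<open>f\<close>.\<close>

locale indiscrete_fibres = cat_multicategory k X C
  for k X and C :: "('x, 'p, 'c) cat_multicat" +
  fixes M :: "('x, 'm) multicat" and f :: "'p \<Rightarrow> 'm"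
  assumes proj: "multicat_map k X C M f"
    and thin: "\<lbrakk>\<alpha> \<in> cell C p q; \<beta> \<in> cell C p q\<rbrakk> \<Longrightarrow> \<alpha> = \<beta>"
    and cell_proj: "\<alpha> \<in> cell C p q \<Longrightarrow> f p = f q"
    and cell_exists: "\<lbrakk>p \<in> arr C; q \<in> arr C; inp C p = inp C q; out C p = out C q; f p = f q\<rbrakk> \<Longrightarrow>
      \<exists>\<alpha>. \<alpha> \<in> cell C p q"

text \<open>A cell of a discrete target is an identity, so full faithfulness gives one cell between
  parallel arrows with the same image and none otherwise. The bijections on hom-sets amount to a
  bijection on all arrows because a map of multicategories preserves inputs and outputs.\<close>

lemma weakening_indiscrete:
  assumes W: "weakening k X A M \<phi> W"
  obtains b f where "multicat_map k X A W b" "bij_betw b (arr A) (arr W)"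
    "\<And>a. a \<in> arr A \<Longrightarrow> f (b a) = \<phi> a" "indiscrete_fibres k X W M f"
proof -
  obtain b0 b1 f0 f1 where cat: "cat_multicategory k X W"
    and b: "cat_multicat_map k X (discrete A) W b0 b1"
    and f: "cat_multicat_map k X W (discrete M) f0 f1"
    and comm: "\<forall>a \<in> arr A. f0 (b0 a) = \<phi> a"
    and bij: "\<forall>xs x. bij_betw b0 (hom (discrete A) xs x) (hom W xs x)"
    and ff: "\<forall>xs x. \<forall>p \<in> hom W xs x. \<forall>q \<in> hom W xs x.
      bij_betw f1 (cell W p q) (cell (discrete M) (f0 p) (f0 q))"
    using W unfolding weakening_def by (elim conjE exE) (rule that)
  interpret cat_multicategory k X W by (rule cat)
  have b0: "multicat_map k X A W b0"
    by (rule multicat_map_cong[OF b[unfolded cat_multicat_map_def, THEN conjunct1]])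
      (simp_all add: discrete_def)
  have f0: "multicat_map k X W M f0"
    by (rule multicat_map_cong[OF f[unfolded cat_multicat_map_def, THEN conjunct1]])
      (simp_all add: discrete_def)
  have homA: "hom (discrete A) xs x = hom A xs x" for xs x
    by (simp add: hom_def discrete_def)
  have dcell: "cell (discrete M) m n = {l \<in> arr M. l = m \<and> l = n}" for m n
    by (auto simp: cell_def discrete_def)
  have ffD: "bij_betw f1 (cell W p q) {l \<in> arr M. l = f0 p \<and> l = f0 q}"
    if "p \<in> arr W" "q \<in> arr W" "inp W p = inp W q" "out W p = out W q" for p q
    using that ff[rule_format, of p "inp W p" "out W p" q] by (simp add: hom_def dcell)
  have f1: "f1 \<alpha> = f0 p \<and> f1 \<alpha> = f0 q" if \<alpha>: "\<alpha> \<in> cell W p q" for \<alpha> p q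
  proof -
    have "bij_betw f1 (cell W p q) {l \<in> arr M. l = f0 p \<and> l = f0 q}"
      by (rule ffD) (use cell_typed[OF \<alpha>] in simp_all)
    then show ?thesis using bij_betwE \<alpha> by fastforce
  qed
  have "bij_betw b0 (arr A) (arr W)"
    unfolding bij_betw_def
  proof (intro conjI inj_onI set_eqI iffI)
    fix a c assume ac: "a \<in> arr A" "c \<in> arr A" "b0 a = b0 c"
    then have "inp A a = inp A c" "out A a = out A c"
      using multicat_map_typed[OF b0] by metis+
    then have "a \<in> hom A (inp A a) (out A a)" "c \<in> hom A (inp A a) (out A a)"
      using ac by (auto simp: hom_def)
    moreover have "inj_on b0 (hom A (inp A a) (out A a))"
      using bij by (simp add: bij_betw_def homA)
    ultimately show "a = c" using ac(3) by (auto dest: inj_onD)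
  next
    fix p assume "p \<in> arr W"
    then have "p \<in> hom W (inp W p) (out W p)" by (simp add: hom_def)
    also have "\<dots> = b0 ` hom A (inp W p) (out W p)"
      using bij by (simp add: bij_betw_def homA)
    finally show "p \<in> b0 ` arr A" by (auto dest: hom_arr)
  qed (use multicat_map_typed(1)[OF b0] in auto)
  moreover have "indiscrete_fibres k X W M f0"
  proof
    show "multicat_map k X W M f0" by (rule f0)
  next
    fix \<alpha> \<beta> p q assume \<alpha>: "\<alpha> \<in> cell W p q" and \<beta>: "\<beta> \<in> cell W p q"
    have "inj_on f1 (cell W p q)"
      by (rule bij_betw_imp_inj_on, rule ffD) (use cell_typed[OF \<alpha>] in simp_all)
    moreover have "f1 \<alpha> = f0 p" "f1 \<beta> = f0 p" using f1[OF \<alpha>] f1[OF \<beta>] by simp_all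
    ultimately show "\<alpha> = \<beta>" using \<alpha> \<beta> inj_onD[of f1 _ \<alpha> \<beta>] by simp
  next
    fix \<alpha> p q assume "\<alpha> \<in> cell W p q"
    from f1[OF this] show "f0 p = f0 q" by metis
  next
    fix p q assume *: "p \<in> arr W" "q \<in> arr W" "inp W p = inp W q" "out W p = out W q" "f0 p = f0 q"
    have "f0 p \<in> {l \<in> arr M. l = f0 p \<and> l = f0 q}"
      using multicat_map_typed(1)[OF f0 *(1)] *(5) by simp
    also have "\<dots> = f1 ` cell W p q"
      using ffD[OF *(1-4)] by (simp add: bij_betw_def)
    finally show "\<exists>\<alpha>. \<alpha> \<in> cell W p q" by auto
  qed
  ultimately show thesis using comm by (intro that[OF b0, of f0]) simp_all
qed

section \<open>Maps into a Cat-multicategory with indiscrete fibres\<close>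

context indiscrete_fibres
begin

text \<open>A choice of cells between two multicategory maps is itself a multicategory map into the cells:
  composites of chosen cells are parallel to the cells chosen for the composites. Both the
  functoriality of a lifted map and the compatibility of a transformation are instances.\<close>

lemma cell_choice_map:
  assumes B: "multicategory k X B" and F: "multicat_map k X B C F" and G: "multicat_map k X B C G"
    and \<eta>: "\<And>b. b \<in> arr B \<Longrightarrow> \<eta> b \<in> cell C (F b) (G b)"
  shows "multicat_map k X B (cell_multicat C) \<eta>"
proof -
  interpret B: multicategory k X B by (rule B)
  interpret cells: multicategory k X "cell_multicat C" by (rule morphism_level)
  interpret objects: multicategory k X C by (rule object_level)
  have st: "src C (\<eta> b) = F b" "tgt C (\<eta> b) = G b" "\<eta> b \<in> cells C" if "b \<in> arr B" for b
    using cell_typed[OF \<eta>[OF that]] by auto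
  have graph: "multigraph_map B (cell_multicat C) \<eta>"
    using st multicat_map_typed[OF F] by (simp add: multigraph_map_def hom_def cell_simps)
  have typed: "inp (cell_multicat C) (\<eta> b) = inp B b" "out (cell_multicat C) (\<eta> b) = out B b"
    if "b \<in> arr B" for b
    using graph that by (auto simp: multigraph_map_def hom_def)
  show ?thesis
    unfolding multicat_map_def
  proof (intro conjI allI ballI impI)
    fix x assume x: "x \<in> X"
    have "\<eta> (idn B x) \<in> cell C (idn C x) (idn C x)"
      using \<eta>[OF hom_arr[OF B.idn_hom[OF x]]]
      by (simp add: multicat_map_preserves(1)[OF F x] multicat_map_preserves(1)[OF G x])
    moreover have "vid C (idn C x) \<in> cell C (idn C x) (idn C x)"
      using x by (intro vid_cell hom_arr[OF objects.idn_hom])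
    ultimately show "\<eta> (idn B x) = idn (cell_multicat C) x"
      unfolding cell_simps by (rule thin)
  next
    fix b bs assume c: "composable B b bs"
    then have bs: "b \<in> arr B" "set bs \<subseteq> arr B" by (auto simp: composable_def)
    have eq: "map (out (cell_multicat C)) (map \<eta> bs) = map (out B) bs"
      using typed(2) bs unfolding map_map by (intro map_cong) auto
    have comp: "composable (cell_multicat C) (\<eta> b) (map \<eta> bs)"
      using c bs st(3) typed(1) unfolding composable_def eq by (auto simp: cell_simps(1))
    have maps: "map (src C) (map \<eta> bs) = map F bs" "map (tgt C) (map \<eta> bs) = map G bs"
      using st bs by auto
    have "cmcomp C (\<eta> b) (map \<eta> bs) \<in> cell C (F (mcomp B b bs)) (G (mcomp B b bs))"
      using hom_arr[OF cells.mcomp_hom[OF comp]] multicat_map_preserves(2)[OF src_map comp]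
        multicat_map_preserves(2)[OF tgt_map comp] multicat_map_preserves(2)[OF F c]
        multicat_map_preserves(2)[OF G c] st(1,2)[OF bs(1)]
      unfolding maps by (simp add: cell_def cell_simps)
    then show "\<eta> (mcomp B b bs) = mcomp (cell_multicat C) (\<eta> b) (map \<eta> bs)"
      unfolding cell_simps using \<eta>[OF hom_arr[OF B.mcomp_hom[OF c]]] thin by blast
  next
    fix b \<sigma> assume k: "k = Symmetric" and b: "b \<in> arr B" and \<sigma>: "\<sigma> permutes {..<length (inp B b)}"
    have c: "\<eta> b \<in> arr (cell_multicat C)" "\<sigma> permutes {..<length (inp (cell_multicat C) (\<eta> b))}"
      using b \<sigma> typed(1) st(3) by (auto simp: cell_simps(1))
    have "cact C \<sigma> (\<eta> b) \<in> cell C (F (act B \<sigma> b)) (G (act B \<sigma> b))"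
      using hom_arr[OF cells.act_hom[OF k c]] multicat_map_preserves(3)[OF src_map k c]
        multicat_map_preserves(3)[OF tgt_map k c] multicat_map_preserves(3)[OF F k b \<sigma>]
        multicat_map_preserves(3)[OF G k b \<sigma>] st(1,2)[OF b]
      by (simp add: cell_def cell_simps)
    then show "\<eta> (act B \<sigma> b) = act (cell_multicat C) \<sigma> (\<eta> b)"
      unfolding cell_simps using \<eta>[OF hom_arr[OF B.act_hom[OF k b \<sigma>]]] thin by blast
  qed (rule graph)
qed

lemma cell_choice_exists:
  assumes F: "multicat_map k X B C F" and G: "multicat_map k X B C G"
    and eq: "\<And>b. b \<in> arr B \<Longrightarrow> f (F b) = f (G b)"
  obtains \<eta> where "\<And>b. b \<in> arr B \<Longrightarrow> \<eta> b \<in> cell C (F b) (G b)"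
proof -
  have "\<forall>b \<in> arr B. \<exists>\<alpha>. \<alpha> \<in> cell C (F b) (G b)"
    using multicat_map_typed[OF F] multicat_map_typed[OF G] eq by (auto intro: cell_exists)
  then show thesis using that by metis
qed

lemma cell_choice_transformation:
  assumes B: "cat_multicategory k X B"
    and F: "multicat_map k X B C F0" "\<And>\<alpha>. \<alpha> \<in> cells B \<Longrightarrow> F1 \<alpha> \<in> cell C (F0 (src B \<alpha>)) (F0 (tgt B \<alpha>))"
    and G: "multicat_map k X B C G0" "\<And>\<alpha>. \<alpha> \<in> cells B \<Longrightarrow> G1 \<alpha> \<in> cell C (G0 (src B \<alpha>)) (G0 (tgt B \<alpha>))"
    and \<eta>: "\<And>b. b \<in> arr B \<Longrightarrow> \<eta> b \<in> cell C (F0 b) (G0 b)"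
  shows "transformation k X B C F0 F1 G0 G1 \<eta>"
proof -
  interpret B: cat_multicategory k X B by (rule B)
  have "multicat_map k X B (cell_multicat C) \<eta>"
    by (rule cell_choice_map[OF B.object_level F(1) G(1) \<eta>])
  note pres = multicat_map_preserves[OF this, unfolded cell_simps]
  have "vcomp C (\<eta> q) (F1 \<alpha>) = vcomp C (G1 \<alpha>) (\<eta> p)" if "\<alpha> \<in> cell B p q" for p q \<alpha>
    using B.cell_typed[OF that] F(2) G(2) \<eta> by (blast intro: thin vcomp_cell)
  then show ?thesis
    unfolding transformation_def using \<eta> pres by simp
qed

text \<open>The cells of the two opposite transformations compose to endomorphisms, which thinness forces
  to be identities.\<close>

lemma isomorphic_over:
  assumes B: "cat_multicategory k X B"
    and F: "multicat_map k X B C F0" "\<And>\<alpha>. \<alpha> \<in> cells B \<Longrightarrow> F1 \<alpha> \<in> cell C (F0 (src B \<alpha>)) (F0 (tgt B \<alpha>))"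
    and G: "multicat_map k X B C G0" "\<And>\<alpha>. \<alpha> \<in> cells B \<Longrightarrow> G1 \<alpha> \<in> cell C (G0 (src B \<alpha>)) (G0 (tgt B \<alpha>))"
    and eq: "\<And>b. b \<in> arr B \<Longrightarrow> f (F0 b) = f (G0 b)"
  shows "isomorphic_maps k X B C F0 F1 G0 G1"
proof -
  obtain \<eta> where \<eta>: "\<And>b. b \<in> arr B \<Longrightarrow> \<eta> b \<in> cell C (F0 b) (G0 b)"
    using cell_choice_exists[OF F(1) G(1) eq] by blast
  obtain \<theta> where \<theta>: "\<And>b. b \<in> arr B \<Longrightarrow> \<theta> b \<in> cell C (G0 b) (F0 b)"
    using cell_choice_exists[OF G(1) F(1) eq[symmetric]] by blast
  have "vcomp C (\<theta> b) (\<eta> b) = vid C (F0 b) \<and> vcomp C (\<eta> b) (\<theta> b) = vid C (G0 b)"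
    if b: "b \<in> arr B" for b
    using \<eta>[OF b] \<theta>[OF b] cell_typed(1,2)[OF \<eta>[OF b]] by (blast intro: thin vcomp_cell vid_cell)
  then show ?thesis
    unfolding isomorphic_maps_def
    using cell_choice_transformation[OF B F G \<eta>] cell_choice_transformation[OF B G F \<theta>] by blast
qed

end

text \<open>The cell part is a choice of cells between the composites of \<open>F0\<close> with \<open>src C\<close> and with \<open>tgt C\<close>.
  These composites agree over \<open>M\<close> since a cell has its ends in the same fibre.\<close>

lemma lift_map:
  assumes C: "indiscrete_fibres k X C M f" and D: "indiscrete_fibres k X D M g"
    and F0: "multicat_map k X C D F0" and over: "\<And>p. p \<in> arr C \<Longrightarrow> g (F0 p) = f p"
  obtains F1 where "cat_multicat_map k X C D F0 F1"
proof -
  interpret C: indiscrete_fibres k X C M f by (rule C)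
  interpret D: indiscrete_fibres k X D M g by (rule D)
  note ends = multicat_map_comp[OF C.src_map F0] multicat_map_comp[OF C.tgt_map F0]
  have "g ((F0 \<circ> src C) \<alpha>) = g ((F0 \<circ> tgt C) \<alpha>)" if "\<alpha> \<in> arr (cell_multicat C)" for \<alpha>
  proof -
    have "\<alpha> \<in> cell C (src C \<alpha>) (tgt C \<alpha>)" using that by (simp add: cell_def cell_simps)
    then show ?thesis using C.cell_typed(1,2) C.cell_proj over by fastforce
  qed
  then obtain F1 where F1: "\<And>\<alpha>. \<alpha> \<in> arr (cell_multicat C) \<Longrightarrow>
      F1 \<alpha> \<in> cell D ((F0 \<circ> src C) \<alpha>) ((F0 \<circ> tgt C) \<alpha>)"
    using D.cell_choice_exists[OF ends] by blast
  have map: "multicat_map k X (cell_multicat C) (cell_multicat D) F1"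
    by (rule D.cell_choice_map[OF C.morphism_level ends F1])
  have F1': "F1 \<alpha> \<in> cell D (F0 p) (F0 q)" if "\<alpha> \<in> cell C p q" for \<alpha> p q
    using F1[of \<alpha>] C.cell_typed[OF that] by (simp add: cell_simps)
  have vid: "F1 (vid C p) = vid D (F0 p)" if "p \<in> arr C" for p
    using F1'[OF C.vid_cell[OF that]] D.vid_cell[OF multicat_map_typed(1)[OF F0 that]]
    by (rule D.thin)
  have vcomp: "F1 (vcomp C \<beta> \<alpha>) = vcomp D (F1 \<beta>) (F1 \<alpha>)"
    if "\<alpha> \<in> cell C p q" "\<beta> \<in> cell C q r" for \<alpha> \<beta> p q r
    using F1'[OF C.vcomp_cell[OF that]] D.vcomp_cell[OF F1'[OF that(1)] F1'[OF that(2)]]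
    by (rule D.thin)
  have "F1 \<alpha> \<in> cell D (F0 (src C \<alpha>)) (F0 (tgt C \<alpha>))" if "\<alpha> \<in> cells C" for \<alpha>
    using that by (intro F1') (simp add: cell_def)
  then have "cat_multicat_map k X C D F0 F1"
    unfolding cat_multicat_map_def using F0 map vid vcomp by blast
  then show thesis by (rule that)
qed

text \<open>Both round trips lie over \<open>M\<close>, as the identities do, so they are isomorphic to the identities
  even when they are far from bijective.\<close>

lemma equivalent_over:
  assumes C: "indiscrete_fibres k X C M f" and D: "indiscrete_fibres k X D M g"
    and F: "multicat_map k X C D F0" "\<And>p. p \<in> arr C \<Longrightarrow> g (F0 p) = f p"
    and G: "multicat_map k X D C G0" "\<And>p. p \<in> arr D \<Longrightarrow> f (G0 p) = g p"
  shows "cat_equivalent k X C D"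
proof -
  interpret C: indiscrete_fibres k X C M f by (rule C)
  interpret D: indiscrete_fibres k X D M g by (rule D)
  obtain F1 where F1: "cat_multicat_map k X C D F0 F1" using lift_map[OF C D F] by blast
  obtain G1 where G1: "cat_multicat_map k X D C G0 G1" using lift_map[OF D C G] by blast
  have c: "F1 \<alpha> \<in> cell D (F0 (src C \<alpha>)) (F0 (tgt C \<alpha>))" if "\<alpha> \<in> cells C" for \<alpha>
    using F1 that by (simp add: cat_multicat_map_def)
  have d: "G1 \<alpha> \<in> cell C (G0 (src D \<alpha>)) (G0 (tgt D \<alpha>))" if "\<alpha> \<in> cells D" for \<alpha>
    using G1 that by (simp add: cat_multicat_map_def)
  have GF: "(G1 \<circ> F1) \<alpha> \<in> cell C ((G0 \<circ> F0) (src C \<alpha>)) ((G0 \<circ> F0) (tgt C \<alpha>))"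
    if "\<alpha> \<in> cells C" for \<alpha>
    using D.cell_typed(5-7)[OF c[OF that]] d[of "F1 \<alpha>"] by simp
  have FG: "(F1 \<circ> G1) \<alpha> \<in> cell D ((F0 \<circ> G0) (src D \<alpha>)) ((F0 \<circ> G0) (tgt D \<alpha>))"
    if "\<alpha> \<in> cells D" for \<alpha>
    using C.cell_typed(5-7)[OF d[OF that]] c[of "G1 \<alpha>"] by simp
  have idC: "id \<alpha> \<in> cell C (id (src C \<alpha>)) (id (tgt C \<alpha>))" if "\<alpha> \<in> cells C" for \<alpha>
    using that by (simp add: cell_def)
  have idD: "id \<alpha> \<in> cell D (id (src D \<alpha>)) (id (tgt D \<alpha>))" if "\<alpha> \<in> cells D" for \<alpha>
    using that by (simp add: cell_def)
  have "isomorphic_maps k X C C id id (G0 \<circ> F0) (G1 \<circ> F1)"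
    using F G multicat_map_typed(1)[OF F(1)]
    by (intro C.isomorphic_over C.cat_multicategory_axioms multicat_map_id idC GF
        multicat_map_comp[OF F(1) G(1)]) simp_all
  moreover have "isomorphic_maps k X D D (F0 \<circ> G0) (F1 \<circ> G1) id id"
    using F G multicat_map_typed(1)[OF G(1)]
    by (intro D.isomorphic_over D.cat_multicategory_axioms multicat_map_id idD FG
        multicat_map_comp[OF G(1) F(1)]) simp_all
  ultimately show ?thesis
    unfolding cat_equivalent_def using F1 G1 by blast
qed

section \<open>Free multicategories are projective\<close>

lemma free_projective:
  fixes B :: "('x, 'b) multicat" and M :: "('x, 'm) multicat" and E :: "('x, 'e) multigraph"
  assumes E: "multigraph X E" and B: "multicategory k X B" and M: "multicategory k X M"
    and \<phi>: "multicat_map k X (free k X E) M \<phi>"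
    and \<psi>: "multicat_map k X B M \<psi>" and surj: "\<psi> ` arr B = arr M"
  obtains g where "multicat_map k X (free k X E) B g"
    "\<And>c. c \<in> arr (free k X E) \<Longrightarrow> \<psi> (g c) = \<phi> c"
proof -
  let ?F = "free k X E" and ?u = "free_unit k X E"
  have forget: "hom (forget N) xs x = hom N xs x" for N :: "('x, 'n) multicat" and xs x
    by (simp add: hom_def forget_def multigraph.truncate_def)
  have u: "?u e \<in> hom ?F (inp E e) (out E e)" if "e \<in> arr E" for e
    using free_unit_map[OF E, of k] that by (simp add: multigraph_map_def forget)
  have \<phi>u: "\<phi> (?u e) \<in> hom M (inp E e) (out E e)" if "e \<in> arr E" for e
    using u[OF that] multicat_map_typed[OF \<phi>, of "?u e"] by (simp add: hom_def)
  have "\<forall>e \<in> arr E. \<exists>b. b \<in> arr B \<and> \<psi> b = \<phi> (?u e)"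
    using surj \<phi>u hom_arr by (metis imageE)
  then obtain s where s: "\<And>e. e \<in> arr E \<Longrightarrow> s e \<in> arr B \<and> \<psi> (s e) = \<phi> (?u e)" by metis
  have s_map: "multigraph_map E (forget B) s"
    unfolding multigraph_map_def forget
  proof
    fix e assume "e \<in> arr E"
    then show "s e \<in> hom B (inp E e) (out E e)"
      using s[of e] \<phi>u[of e] multicat_map_typed(2,3)[OF \<psi>, of "s e"] by (simp add: hom_def)
  qed
  have \<phi>u_map: "multigraph_map E (forget M) (\<phi> \<circ> ?u)"
    using \<phi>u by (simp add: multigraph_map_def forget)
  let ?g = "free_ext B s"
  have g: "multicat_map k X ?F B ?g" by (rule free_ext_map[OF E B s_map])
  \<comment> \<open>Both \<open>\<psi> \<circ> ?g\<close> and \<open>\<phi>\<close> are the unique extension of their common restriction to the generators.\<close>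
  have "\<psi> (?g c) = \<phi> c" if c: "c \<in> arr ?F" for c
  proof -
    have "(\<psi> \<circ> ?g) c = free_ext M (\<phi> \<circ> ?u) c"
      by (rule free_ext_unique[OF E M \<phi>u_map multicat_map_comp[OF g \<psi>] _ c])
        (simp add: free_ext_unit[OF E B s_map] s)
    also have "\<dots> = \<phi> c"
      by (rule free_ext_unique[OF E M \<phi>u_map \<phi> _ c, symmetric]) simp
    finally show ?thesis by simp
  qed
  with g show thesis by (rule that)
qed

lemma multigraph_forget:
  assumes "multicategory k X M"
  shows "multigraph X (forget M)"
  using multicategory.graph[OF assms]
  by (simp add: multigraph_def forget_def multigraph.truncate_def)

lemma counit_map:
  assumes "multicategory k X M"
  shows "multicat_map k X (free k X (forget M)) M (counit M)"
  unfolding counit_def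
  by (rule free_ext_map[OF multigraph_forget[OF assms] assms])
    (auto simp: multigraph_map_def hom_def)

text \<open>The triangle identity makes the unit a section of the counit on arrows.\<close>

lemma counit_surj:
  assumes M: "multicategory k X M"
  shows "counit M ` arr (free k X (forget M)) = arr M"
proof
  show "counit M ` arr (free k X (forget M)) \<subseteq> arr M"
    using multicat_map_typed(1)[OF counit_map[OF M]] by auto
  show "arr M \<subseteq> counit M ` arr (free k X (forget M))"
  proof
    fix m assume "m \<in> arr M"
    then have m: "m \<in> arr (forget M)" by (simp add: forget_def multigraph.truncate_def)
    have "counit M (free_unit k X (forget M) m) = m"
      unfolding counit_def
      by (rule free_ext_unit[OF multigraph_forget[OF M] M _ m]) (auto simp: multigraph_map_def hom_def)
    moreover have "free_unit k X (forget M) m \<in> arr (free k X (forget M))"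
      unfolding free_unit_def using m by (intro tclass_arr[OF multigraph_forget[OF M]] terms.Gen)
    ultimately show "m \<in> counit M ` arr (free k X (forget M))" by (metis imageI)
  qed
qed

section \<open>Weakenings along surjections from free multicategories\<close>

lemma multicat_map_inv:
  assumes M: "multicategory k X M" and h: "multicat_map k X M N h" and bij: "bij_betw h (arr M) (arr N)"
  shows "multicat_map k X N M (inv_into (arr M) h)"
proof -
  interpret M: multicategory k X M by (rule M)
  let ?j = "inv_into (arr M) h"
  have j: "?j n \<in> arr M" "h (?j n) = n" if "n \<in> arr N" for n
    using bij that by (auto simp: bij_betw_def inv_into_into f_inv_into_f)
  have jh: "?j (h m) = m" if "m \<in> arr M" for m
    using bij that by (simp add: bij_betw_def)
  have typed: "inp M (?j n) = inp N n" "out M (?j n) = out N n" if "n \<in> arr N" for n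
    using multicat_map_typed(2,3)[OF h j(1)[OF that]] j(2)[OF that] by simp_all
  show ?thesis
    unfolding multicat_map_def
  proof (intro conjI allI ballI impI)
    show "multigraph_map N M ?j" using j(1) typed by (simp add: multigraph_map_def hom_def)
  next
    fix x assume x: "x \<in> X"
    show "?j (idn N x) = idn M x"
      using jh[OF hom_arr[OF M.idn_hom[OF x]]] multicat_map_preserves(1)[OF h x] by simp
  next
    fix n ns assume c: "composable N n ns"
    then have ns: "n \<in> arr N" "set ns \<subseteq> arr N" by (auto simp: composable_def)
    have "map (out M) (map ?j ns) = map (out N) ns"
      using typed(2) ns unfolding map_map by (intro map_cong) auto
    then have c': "composable M (?j n) (map ?j ns)"
      using c ns j(1) typed(1) unfolding composable_def by auto
    have "map h (map ?j ns) = ns" using ns j(2) unfolding map_map by (intro map_idI) auto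
    then have "h (mcomp M (?j n) (map ?j ns)) = mcomp N n ns"
      using multicat_map_preserves(2)[OF h c'] j(2)[OF ns(1)] by simp
    then show "?j (mcomp N n ns) = mcomp M (?j n) (map ?j ns)"
      using jh[OF hom_arr[OF M.mcomp_hom[OF c']]] by simp
  next
    fix n \<sigma> assume k: "k = Symmetric" and n: "n \<in> arr N" and \<sigma>: "\<sigma> permutes {..<length (inp N n)}"
    have \<sigma>': "\<sigma> permutes {..<length (inp M (?j n))}" using \<sigma> typed(1)[OF n] by simp
    have "h (act M \<sigma> (?j n)) = act N \<sigma> n"
      using multicat_map_preserves(3)[OF h k j(1)[OF n] \<sigma>'] j(2)[OF n] by simp
    then show "?j (act N \<sigma> n) = act M \<sigma> (?j n)"
      using jh[OF hom_arr[OF M.act_hom[OF k j(1)[OF n] \<sigma>']]] by simp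
  qed
qed

text \<open>Since the underlying multicategory of a weakening is isomorphic over \<open>M\<close> to the domain of the
  weakened map, a free domain makes the weakening map to any other weakening of \<open>M\<close> along a
  surjection.\<close>

lemma weakening_free_map:
  fixes B :: "('x, 'b) multicat" and M :: "('x, 'm) multicat" and E :: "('x, 'e) multigraph"
  assumes M: "multicategory k X M" and E: "multigraph X E" and B: "multicategory k X B"
    and \<phi>: "multicat_map k X (free k X E) M \<phi>"
    and \<psi>: "multicat_map k X B M \<psi>" "\<psi> ` arr B = arr M"
    and b: "multicat_map k X (free k X E) W b" "bij_betw b (arr (free k X E)) (arr W)"
      "\<And>a. a \<in> arr (free k X E) \<Longrightarrow> f (b a) = \<phi> a"
    and b': "multicat_map k X B W' b'" "\<And>a. a \<in> arr B \<Longrightarrow> f' (b' a) = \<psi> a"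
  obtains h where "multicat_map k X W W' h" "\<And>p. p \<in> arr W \<Longrightarrow> f' (h p) = f p"
proof -
  let ?A = "free k X E" and ?j = "inv_into (arr (free k X E)) b"
  obtain g where g: "multicat_map k X ?A B g" "\<And>c. c \<in> arr ?A \<Longrightarrow> \<psi> (g c) = \<phi> c"
    using free_projective[OF E B M \<phi> \<psi>] by blast
  note j = multicat_map_inv[OF multicategory_free[OF E] b(1,2)]
  have "f' ((b' \<circ> (g \<circ> ?j)) p) = f p" if p: "p \<in> arr W" for p
  proof -
    have jp: "?j p \<in> arr ?A" "b (?j p) = p"
      using p b(2) by (auto simp: bij_betw_def inv_into_into f_inv_into_f)
    have "f' (b' (g (?j p))) = \<phi> (?j p)"
      using b'(2) g(2) jp(1) multicat_map_typed(1)[OF g(1) jp(1)] by simp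
    also have "\<dots> = f p" using b(3)[OF jp(1)] jp(2) by simp
    finally show ?thesis by simp
  qed
  then show thesis using that multicat_map_comp[OF multicat_map_comp[OF j g(1)] b'(1)] by blast
qed

theorem theorem5p3p7:
  fixes k :: flavour and X :: "'x set"
    and M :: "('x, 'm) multicat" and \<Phi> :: "('x, 'e) multigraph"
    and \<phi> :: "('x, 'e) mterm set \<Rightarrow> 'm"
    and W :: "('x, 'p, 'c) cat_multicat" and W' :: "('x, 'q, 'd) cat_multicat"
  assumes "multicategory k X M"
    and "multigraph X \<Phi>"
    and "regular_epi k X (free k X \<Phi>) M \<phi>"
    and "weakening k X (free k X \<Phi>) M \<phi> W"
    and "unbiased_weakening k X M W'"
  shows "cat_equivalent k X W W'"
proof -
  note M = assms(1) and \<Phi> = assms(2)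
  note U = multigraph_forget[OF M]
  note A = multicategory_free[OF \<Phi>, of k] and B = multicategory_free[OF U, of k]
  have \<phi>: "multicat_map k X (free k X \<Phi>) M \<phi>"
    using assms(3) by (auto simp: regular_epi_def coequalizer_def)
  note surj = regular_epi_surj[OF assms(3)]
  note \<epsilon> = counit_map[OF M] and \<epsilon>_surj = counit_surj[OF M]
  obtain b f where b: "multicat_map k X (free k X \<Phi>) W b"
      "bij_betw b (arr (free k X \<Phi>)) (arr W)"
      "\<And>a. a \<in> arr (free k X \<Phi>) \<Longrightarrow> f (b a) = \<phi> a"
    and W: "indiscrete_fibres k X W M f"
    using weakening_indiscrete[OF assms(4)] by blast
  obtain b' f' where b': "multicat_map k X (free k X (forget M)) W' b'"
      "bij_betw b' (arr (free k X (forget M))) (arr W')"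
      "\<And>a. a \<in> arr (free k X (forget M)) \<Longrightarrow> f' (b' a) = counit M a"
    and W': "indiscrete_fibres k X W' M f'"
    using weakening_indiscrete[OF assms(5)[unfolded unbiased_weakening_def]] by blast
  obtain F where F: "multicat_map k X W W' F" "\<And>p. p \<in> arr W \<Longrightarrow> f' (F p) = f p"
    using weakening_free_map[OF M \<Phi> B \<phi> \<epsilon> \<epsilon>_surj b b'(1,3)] by blast
  obtain G where G: "multicat_map k X W' W G" "\<And>p. p \<in> arr W' \<Longrightarrow> f (G p) = f' p"
    using weakening_free_map[OF M U A \<epsilon> \<phi> surj b' b(1,3)] by blast
  show ?thesis by (rule equivalent_over[OF W W' F(1) _ G(1)]) (use F(2) G(2) in simp_all)
qed

end
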